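(* Let $T>0$ and $0<\alpha<\frac12$. Assume that $b$ satisfies (H2) with $\rho=\frac1\alpha$ and $\mu>\max\{1-\alpha,\alpha\}$. For $f:[0,T]\to\mathbb R^d$ put $F^{(b)}_t(f)=\int_0^t b(t,s,f(s))\,ds$. 1. If $f\in W_0^{\alpha,\infty}(0,T;\mathbb R^d)$, then $F^{(b)}_\cdot(f)\in C^{1-\alpha}(0,T;\mathbb R^d)$ and, for all $\lambda\ge1$, $$\|F^{(b)}(f)\|_{1-\alpha}\le d^{(1)}(1+\|f\|_\infty),\qquad \|F^{(b)}(f)\|_{\alpha,\lambda}\le\frac{d^{(2)}}{\lambda^{1-2\alpha}}(1+\|f\|_{\alpha,\lambda}),$$ where $d^{(1)},d^{(2)}$ are positive constants depending only on $\mu,\alpha,T,L,L_0$ and a constant $B_{0,\alpha}$ that depends on $b$ (in particular they do not depend on $f$ or $\lambda$). 2. If $f,h\in W_0^{\alpha,\infty}(0,T;\mathbb R^d)$ satisfy $\|f\|_\infty\le N$ and $\|h\|_\infty\le N$, then for all $\lambda\ge1$ $$\|F^{(b)}(f)-F^{(b)}(h)\|_{\alpha,\lambda}\le\frac{d_N}{\lambda^{1-\alpha}}\|f-h\|_{\alpha,\lambda},$$ where $d_N$ depends only on $\alpha$, $T$ and the constant $L_N$ of (H2).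
   Context: Norms and spaces. $\|f\|_\infty=\sup_{s\in[0,T]}|f(s)|$. $W_0^{\alpha,\infty}(0,T;\mathbb R^d)$ is the space of measurable $f:[0,T]\to\mathbb R^d$ with $\sup_{t\in[0,T]}\big(|f(t)|+\int_0^t\frac{|f(t)-f(s)|}{(t-s)^{\alpha+1}}ds\big)<\infty$; for $\lambda\ge1$ it carries the equivalent norm $$\|f\|_{\alpha,\lambda}:=\sup_{t\in[0,T]}e^{-\lambda t}\Big(|f(t)|+\int_0^t\frac{|f(t)-f(s)|}{(t-s)^{\alpha+1}}ds\Big).$$ For $0<\kappa\le1$, $C^{\kappa}(0,T;\mathbb R^d)$ is the space of $f:[0,T]\to\mathbb R^d$ with $\|f\|_\kappa:=\|f\|_\infty+\sup_{0\le s<t\le T}\frac{|f(t)-f(s)|}{(t-s)^\kappa}<\infty$. (H2) $b:[0,T]^2\times\mathbb R^d\to\mathbb R^d$ is measurable and there are $\rho\ge2$, a nonnegative $b_0\in L^\rho([0,T]^2)$, $0<\mu\le1$, constants $L,L_0>0$ and, for every $N\ge0$, a constant $L_N>0$ such that (all times in $[0,T]$): 1. $|b(t,s,x)-b(t,s,y)|\le L_N|x-y|$ for all $|x|,|y|\le N$; 2. $|b(t_1,s,x)-b(t_2,s,x)|\le L|t_1-t_2|^\mu$ for all $x\in\mathbb R^d$; 3. $|b(t,s,x)|\le L_0|x|+b_0(t,s)$ for all $x\in\mathbb R^d$; 4. $|b(t_1,s,x_1)-b(t_1,s,x_2)-b(t_2,s,x_1)+b(t_2,s,x_2)|\le L_N|t_1-t_2||x_1-x_2|$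 for all $|x_1|,|x_2|\le N$. *)

theory Defs
  imports "HOL-Analysis.Analysis"
begin

text \<open>
  A function on \<open>[0,T]\<close> is represented by a function on the whole of \<^typ>\<open>real\<close> of which only the
  values on \<open>{0..T}\<close> matter. The norms take values in \<^typ>\<open>ennreal\<close>, so that an unbounded
  supremum or a divergent integral is \<open>\<infinity>\<close>.
\<close>

definition sup_norm :: "real \<Rightarrow> (real \<Rightarrow> 'a::real_normed_vector) \<Rightarrow> ennreal" where
  "sup_norm T f = (SUP t\<in>{0..T}. ennreal (norm (f t)))"

definition frac_int :: "real \<Rightarrow> (real \<Rightarrow> 'a::real_normed_vector) \<Rightarrow> real \<Rightarrow> ennreal" where
  "frac_int \<alpha> f t =
    (\<integral>\<^sup>+s\<in>{0..t}. ennreal (norm (f t - f s) / (t - s) powr (\<alpha> + 1)) \<partial>lebesgue)"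

definition alpha_norm ::
  "real \<Rightarrow> real \<Rightarrow> real \<Rightarrow> (real \<Rightarrow> 'a::real_normed_vector) \<Rightarrow> ennreal" where
  "alpha_norm T \<alpha> l f =
    (SUP t\<in>{0..T}. ennreal (exp (- l * t)) * (ennreal (norm (f t)) + frac_int \<alpha> f t))"

definition W0_space :: "real \<Rightarrow> real \<Rightarrow> (real \<Rightarrow> real ^ 'n) set" where
  "W0_space T \<alpha> = {f. f \<in> borel_measurable (lebesgue_on {0..T}) \<and>
     (SUP t\<in>{0..T}. ennreal (norm (f t)) + frac_int \<alpha> f t) < \<infinity>}"

definition hoelder_norm :: "real \<Rightarrow> real \<Rightarrow> (real \<Rightarrow> 'a::real_normed_vector) \<Rightarrow> ennreal" where
  "hoelder_norm T \<kappa> f = sup_norm T f +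
     (SUP (s, t)\<in>{(s, t). 0 \<le> s \<and> s < t \<and> t \<le> T}. ennreal (norm (f t - f s) / (t - s) powr \<kappa>))"

definition hoelder_space :: "real \<Rightarrow> real \<Rightarrow> (real \<Rightarrow> real ^ 'n) set" where
  "hoelder_space T \<kappa> = {f. hoelder_norm T \<kappa> f < \<infinity>}"

text \<open>
  Hypothesis (H2), with all the constants it involves as parameters; \<open>LN N\<close> is the local constant
  \<open>L\<^sub>N\<close>.
\<close>

definition H2 :: "real \<Rightarrow> (real \<Rightarrow> real \<Rightarrow> real ^ 'n \<Rightarrow> real ^ 'n) \<Rightarrow> real \<Rightarrow>
    (real \<Rightarrow> real \<Rightarrow> real) \<Rightarrow> real \<Rightarrow> real \<Rightarrow> real \<Rightarrow> (real \<Rightarrow> real) \<Rightarrow> bool" where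
  "H2 T b \<rho> b0 \<mu> L L0 LN \<longleftrightarrow>
    (\<lambda>(t, s, x). b t s x) \<in> borel_measurable (restrict_space borel ({0..T} \<times> {0..T} \<times> UNIV)) \<and>
    2 \<le> \<rho> \<and>
    (\<forall>t\<in>{0..T}. \<forall>s\<in>{0..T}. 0 \<le> b0 t s) \<and>
    (\<lambda>(t, s). b0 t s) \<in> borel_measurable (lebesgue_on ({0..T} \<times> {0..T})) \<and>
    integrable (lebesgue_on ({0..T} \<times> {0..T})) (\<lambda>(t, s). b0 t s powr \<rho>) \<and>
    0 < \<mu> \<and> \<mu> \<le> 1 \<and> 0 < L \<and> 0 < L0 \<and> (\<forall>N\<ge>0. 0 < LN N) \<and>
    (\<forall>N\<ge>0. \<forall>t\<in>{0..T}. \<forall>s\<in>{0..T}. \<forall>x y. norm x \<le> N \<longrightarrow> norm y \<le> N \<longrightarrow>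
       norm (b t s x - b t s y) \<le> LN N * norm (x - y)) \<and>
    (\<forall>t1\<in>{0..T}. \<forall>t2\<in>{0..T}. \<forall>s\<in>{0..T}. \<forall>x.
       norm (b t1 s x - b t2 s x) \<le> L * \<bar>t1 - t2\<bar> powr \<mu>) \<and>
    (\<forall>t\<in>{0..T}. \<forall>s\<in>{0..T}. \<forall>x. norm (b t s x) \<le> L0 * norm x + b0 t s) \<and>
    (\<forall>N\<ge>0. \<forall>t1\<in>{0..T}. \<forall>t2\<in>{0..T}. \<forall>s\<in>{0..T}. \<forall>x1 x2. norm x1 \<le> N \<longrightarrow> norm x2 \<le> N \<longrightarrow>
       norm (b t1 s x1 - b t1 s x2 - b t2 s x1 + b t2 s x2) \<le> LN N * \<bar>t1 - t2\<bar> * norm (x1 - x2))"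

definition F_op ::
  "(real \<Rightarrow> real \<Rightarrow> real ^ 'n \<Rightarrow> real ^ 'n) \<Rightarrow> (real \<Rightarrow> real ^ 'n) \<Rightarrow> real \<Rightarrow> real ^ 'n" where
  "F_op b f t = (LINT s:{0..t}|lebesgue. b t s (f s))"

end

theory Submission imports Defs begin

text \<open>
  Write \<open>F\<^sub>t - F\<^sub>s\<close> as the integral of \<open>b t u (f u)\<close> over \<open>[s,t]\<close> plus the integral over \<open>[0,s]\<close> of the
  change of the kernel in its first variable (\<open>norm_volterra_increment_le\<close>). Every claim is read
  off from bounds on these two pieces.

  The growth condition bounds the first piece by a multiple of the integral of \<open>|f|\<close> over \<open>[s,t]\<close>
  plus the integral of \<open>b\<^sub>0(t, \<cdot>)\<close>. Integrability of \<open>b\<^sub>0\<close> on the square says nothing about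
  the section at a prescribed \<open>t\<close>. By Fubini, however, some section \<open>b\<^sub>0(r, \<cdot>)\<close> has a
  \<open>1/\<alpha>\<close>-th moment at most one above the mean of these moments (\<open>obtain_Lp_section\<close>), and the
  Hoelder condition in time replaces \<open>b t u x\<close> by \<open>b r u x\<close> at the cost of \<open>L T\<^sup>\<mu>\<close> (\<open>H2_growth\<close>).
  Hoelder's inequality, which \<open>le_powr_split\<close> replaces by a pointwise estimate, then gives
  \<open>(t - s)\<^sup>1\<^sup>-\<^sup>\<alpha>\<close> for the integral of that section over \<open>[s,t]\<close>. The second piece is at most
  \<open>L T (t - s)\<^sup>\<mu>\<close>, and \<open>\<mu> > 1 - \<alpha>\<close>.

  For the weighted norms, \<open>|f u| \<le> M e\<^sup>l\<^sup>u\<close> makes the integral of \<open>|f|\<close> over \<open>[s,t]\<close> at most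
  \<open>M e\<^sup>l\<^sup>t min (t - s) (1/l)\<close>. Dividing by \<open>(t - s)\<^sup>\<alpha>\<^sup>+\<^sup>1\<close> and integrating in \<open>s\<close> gives a constant times
  \<open>l\<^sup>\<alpha>\<^sup>-\<^sup>1\<close> (\<open>nn_integral_min_kernel_le\<close>), the decay in the Lipschitz estimate. In the growth estimate
  the term \<open>(t - s)\<^sup>1\<^sup>-\<^sup>\<alpha>\<close> decays more slowly: it contributes \<open>e\<^sup>-\<^sup>l\<^sup>t t\<^sup>1\<^sup>-\<^sup>2\<^sup>\<alpha>\<close>, which is at most \<open>l\<^sup>2\<^sup>\<alpha>\<^sup>-\<^sup>1\<close>
  (\<open>powr_exp_le\<close>). For a difference \<open>F(f) - F(h)\<close> the mixed Lipschitz condition makes the second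
  piece at most \<open>L\<^sub>N M e\<^sup>l\<^sup>t (t - s) / l\<close>, which is linear in \<open>t - s\<close> and already carries a factor
  \<open>1/l\<close>. The passage from increments to the weighted norm is common to both
  (\<open>alpha_norm_le_of_increments\<close>).
\<close>

section \<open>One-dimensional integrals\<close>

lemma nn_integral_powr_Icc_0:
  fixes c t :: real
  assumes "0 < c" "0 \<le> t"
  shows "(\<integral>\<^sup>+r\<in>{0..t}. ennreal (r powr (c - 1)) \<partial>lborel) = ennreal (t powr c / c)"
proof -
  have "((\<lambda>r. r powr (c - 1)) has_integral (t powr c / c)) {0..t}"
    using has_integral_powr_from_0[of "c - 1" t] assms by simp
  from nn_integral_has_integral_lebesgue'[OF _ this] show ?thesis by simp
qed

lemma nn_integral_reflect_Icc:
  fixes g :: "real \<Rightarrow> ennreal"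
  assumes [measurable]: "g \<in> borel_measurable borel"
  shows "(\<integral>\<^sup>+s\<in>{0..t}. g (t - s) \<partial>lborel) = (\<integral>\<^sup>+r\<in>{0..t}. g r \<partial>lborel)"
proof -
  have "(\<integral>\<^sup>+r\<in>{0..t}. g r \<partial>lborel) = (\<integral>\<^sup>+s. g (t - s) * indicator {0..t} (t - s) \<partial>lborel)"
    using nn_integral_real_affine[of "\<lambda>r. g r * indicator {0..t} r" "-1" t] by simp
  also have "\<dots> = (\<integral>\<^sup>+s\<in>{0..t}. g (t - s) \<partial>lborel)"
    by (intro nn_integral_cong) (auto split: split_indicator)
  finally show ?thesis by simp
qed

text \<open>
  Both entries of the minimum are used: near \<open>s = t\<close> the length \<open>t - s\<close> tames the singular kernel of
  \<^const>\<open>frac_int\<close>, while away from it \<open>1 / l\<close> supplies the decay in \<open>l\<close>.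
\<close>

lemma nn_integral_exp_Icc_le:
  fixes s t l M :: real
  assumes "s \<le> t" "0 < l" "0 \<le> M"
  shows "(\<integral>\<^sup>+u\<in>{s..t}. ennreal (M * exp (l * u)) \<partial>lborel)
    \<le> ennreal (M * exp (l * t) * min (t - s) (1 / l))"
proof -
  have 1: "(\<integral>\<^sup>+u\<in>{s..t}. ennreal (M * exp (l * u)) \<partial>lborel) \<le> ennreal (M * exp (l * t) * (t - s))"
  proof -
    have "(\<integral>\<^sup>+u\<in>{s..t}. ennreal (M * exp (l * u)) \<partial>lborel)
       \<le> (\<integral>\<^sup>+u\<in>{s..t}. ennreal (M * exp (l * t)) \<partial>lborel)"
      using assms by (intro nn_integral_mono)
        (auto split: split_indicator intro!: ennreal_leI mult_left_mono)
    also have "\<dots> = ennreal (M * exp (l * t) * (t - s))"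
      using assms by (subst nn_integral_cmult_indicator) (auto simp: ennreal_mult)
    finally show ?thesis .
  qed
  have 2: "(\<integral>\<^sup>+u\<in>{s..t}. ennreal (M * exp (l * u)) \<partial>lborel) \<le> ennreal (M * exp (l * t) * (1 / l))"
  proof -
    have "(\<integral>\<^sup>+u. ennreal (M * exp (l * u)) * indicator {s..t} u \<partial>lborel)
      = ennreal (M * exp (l * t) / l - M * exp (l * s) / l)"
      using assms by (intro nn_integral_FTC_Icc)
        (auto intro!: derivative_eq_intros borel_measurable_continuous_onI continuous_intros)
    also have "\<dots> \<le> ennreal (M * exp (l * t) * (1 / l))"
      using assms by (intro ennreal_leI) simp
    finally show ?thesis .
  qed
  show ?thesis using 1 2 by (simp add: min_def)
qed

text \<open>
  Splitting at \<open>r = 1 / l\<close>, where the minimum switches, leaves a power integrable at \<open>0\<close> and a power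
  integrable at infinity. Both parts scale as \<open>l powr (\<alpha> - 1)\<close>, so the bound is uniform in \<open>t\<close>.
\<close>

lemma nn_integral_min_kernel_le:
  fixes \<alpha> l t :: real
  assumes "0 < \<alpha>" "\<alpha> < 1" "0 < l"
  shows "(\<integral>\<^sup>+r\<in>{0..t}. ennreal (min r (1 / l) / r powr (\<alpha> + 1)) \<partial>lborel)
    \<le> ennreal ((1 / (1 - \<alpha>) + 1 / \<alpha>) * l powr (\<alpha> - 1))"
proof -
  let ?near = "\<integral>\<^sup>+r\<in>{0..1/l}. ennreal (r powr ((1 - \<alpha>) - 1)) \<partial>lborel"
  let ?far = "\<integral>\<^sup>+r\<in>{1/l..}. ennreal (r powr (- \<alpha> - 1) / l) \<partial>lborel"
  have near: "?near = ennreal (l powr (\<alpha> - 1) / (1 - \<alpha>))"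
    using nn_integral_powr_Icc_0[of "1 - \<alpha>" "1 / l"] assms
    by (simp add: powr_divide powr_minus powr_diff field_simps)
  have far: "?far = ennreal (0 - (- ((1 / l) powr - \<alpha> / (\<alpha> * l))))"
  proof (rule nn_integral_FTC_atLeast)
    show "((\<lambda>r. - (r powr - \<alpha> / (\<alpha> * l))) has_real_derivative r powr (- \<alpha> - 1) / l) (at r)"
      if "1 / l \<le> r" for r
    proof -
      have "0 < r" using that assms by (meson divide_pos_pos less_le_trans zero_less_one)
      then show ?thesis using assms by (auto intro!: derivative_eq_intros simp: field_simps)
    qed
    have "((\<lambda>r. r powr - \<alpha>) \<longlongrightarrow> 0) at_top"
      using assms by (intro tendsto_neg_powr filterlim_ident) auto
    then have "((\<lambda>r. - (r powr - \<alpha> / (\<alpha> * l))) \<longlongrightarrow> - (0 / (\<alpha> * l))) at_top"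
      using assms by (intro tendsto_intros) auto
    then show "((\<lambda>r. - (r powr - \<alpha> / (\<alpha> * l))) \<longlongrightarrow> 0) at_top" by simp
  qed (use assms in auto)
  have "(1 / l) powr - \<alpha> / (\<alpha> * l) = l powr (\<alpha> - 1) / \<alpha>"
    using assms by (simp add: powr_divide powr_minus powr_diff field_simps)
  with far have far: "?far = ennreal (l powr (\<alpha> - 1) / \<alpha>)" by simp
  have "(\<integral>\<^sup>+r\<in>{0..t}. ennreal (min r (1 / l) / r powr (\<alpha> + 1)) \<partial>lborel)
     \<le> (\<integral>\<^sup>+r. ennreal (r powr ((1 - \<alpha>) - 1)) * indicator {0..1/l} r
           + ennreal (r powr (- \<alpha> - 1) / l) * indicator {1/l..} r \<partial>lborel)"
  proof (rule nn_integral_mono)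
    fix r :: real
    show "ennreal (min r (1 / l) / r powr (\<alpha> + 1)) * indicator {0..t} r
      \<le> ennreal (r powr ((1 - \<alpha>) - 1)) * indicator {0..1/l} r
           + ennreal (r powr (- \<alpha> - 1) / l) * indicator {1/l..} r"
    proof (cases "0 < r")
      case True
      have "r / r powr (\<alpha> + 1) = r powr ((1 - \<alpha>) - 1)"
        using True by (simp add: powr_add powr_minus field_simps)
      moreover have "(1 / l) / r powr (\<alpha> + 1) = r powr (- \<alpha> - 1) / l"
        using True assms by (simp add: powr_add powr_minus powr_diff field_simps)
      ultimately show ?thesis
        using True by (auto split: split_indicator simp: min_def)
    qed (auto split: split_indicator simp: min_def)
  qed
  also have "\<dots> = ?near + ?far"
    by (intro nn_integral_add) auto
  also have "\<dots> = ennreal ((1 / (1 - \<alpha>) + 1 / \<alpha>) * l powr (\<alpha> - 1))"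
    unfolding near far using assms by (subst ennreal_plus[symmetric]) (auto simp: algebra_simps)
  finally show ?thesis .
qed

text \<open>
  A pointwise form of Hoelder's inequality for the pair \<open>(x, 1)\<close>: integrated over an interval of
  length \<open>r\<close>, both summands are of the order \<open>r powr (1 - \<alpha>)\<close> as soon as \<open>x powr (1 / \<alpha>)\<close> has a
  bounded integral. It holds because \<open>1 - 1 / \<alpha> < 0\<close>: if \<open>x\<close> exceeds the threshold \<open>r powr - \<alpha>\<close>,
  then \<open>x powr (1 - 1 / \<alpha>)\<close> is at most the same power of that threshold, namely \<open>r powr (1 - \<alpha>)\<close>.
\<close>

lemma le_powr_split:
  fixes x r \<alpha> :: real
  assumes "0 \<le> x" "0 < r" "0 < \<alpha>" "\<alpha> < 1"
  shows "x \<le> r powr - \<alpha> + r powr (1 - \<alpha>) * x powr (1 / \<alpha>)"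
proof (cases "x \<le> r powr - \<alpha>")
  case False
  moreover have "0 < r powr - \<alpha>" using assms by simp
  ultimately have *: "r powr - \<alpha> \<le> x" "0 < x" "0 < r powr - \<alpha>" by linarith+
  have "x = x powr (1 - 1 / \<alpha>) * x powr (1 / \<alpha>)"
    using *(2) by (simp add: powr_add[symmetric])
  also have "\<dots> \<le> (r powr - \<alpha>) powr (1 - 1 / \<alpha>) * x powr (1 / \<alpha>)"
    using * assms by (intro mult_right_mono powr_mono2') auto
  also have "\<dots> = r powr (1 - \<alpha>) * x powr (1 / \<alpha>)"
  proof -
    have "- \<alpha> * (1 - 1 / \<alpha>) = 1 - \<alpha>" using assms by (simp add: field_simps)
    then show ?thesis by (simp add: powr_powr)
  qed
  finally show ?thesis by (simp add: add_increasing)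
qed (use assms in \<open>simp add: add_increasing2\<close>)

text \<open>
  After multiplication by \<open>l powr c\<close> this says \<open>x powr c \<le> exp x\<close> at \<open>x = l * t\<close>, which follows from
  \<open>x powr c \<le> max 1 x\<close>.
\<close>

lemma powr_exp_le:
  fixes t l c :: real
  assumes "0 \<le> t" "0 < l" "0 \<le> c" "c \<le> 1"
  shows "exp (- l * t) * t powr c \<le> l powr - c"
proof -
  have "(l * t) powr c \<le> exp (l * t)"
  proof (cases "l * t \<le> 1")
    case True
    then have "(l * t) powr c \<le> 1" using assms by (simp add: powr_le1)
    also have "1 \<le> exp (l * t)" using assms by simp
    finally show ?thesis .
  next
    case False
    then have "(l * t) powr c \<le> (l * t) powr 1" using assms by (intro powr_mono) auto
    also have "\<dots> = l * t" using False by simp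
    also have "\<dots> \<le> exp (l * t)" using exp_ge_add_one_self[of "l * t"] by linarith
    finally show ?thesis .
  qed
  then show ?thesis
    using assms by (simp add: powr_mult exp_minus powr_minus field_simps)
qed

section \<open>Weighted and Hoelder norms from increments\<close>

lemma frac_int_le:
  fixes D :: "real \<Rightarrow> 'a::real_normed_vector"
  assumes \<alpha>: "0 < \<alpha>" "\<alpha> < 1" and \<kappa>: "\<alpha> < \<kappa>" and "0 < l" "0 \<le> t" "0 \<le> A" "0 \<le> K"
    and D: "\<And>s. 0 \<le> s \<Longrightarrow> s \<le> t \<Longrightarrow> norm (D t - D s) \<le> A * min (t - s) (1 / l) + K * (t - s) powr \<kappa>"
  shows "frac_int \<alpha> D t
    \<le> ennreal (A * ((1 / (1 - \<alpha>) + 1 / \<alpha>) * l powr (\<alpha> - 1)) + K * (t powr (\<kappa> - \<alpha>) / (\<kappa> - \<alpha>)))"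
proof -
  let ?k = "\<lambda>r. ennreal A * ennreal (min r (1 / l) / r powr (\<alpha> + 1)) + ennreal K * ennreal (r powr ((\<kappa> - \<alpha>) - 1))"
  have "frac_int \<alpha> D t = (\<integral>\<^sup>+s\<in>{0..t}. ennreal (norm (D t - D s) / (t - s) powr (\<alpha> + 1)) \<partial>lborel)"
    by (simp add: frac_int_def nn_integral_completion)
  also have "\<dots> \<le> (\<integral>\<^sup>+s\<in>{0..t}. ?k (t - s) \<partial>lborel)"
  proof (rule nn_integral_mono)
    fix s
    show "ennreal (norm (D t - D s) / (t - s) powr (\<alpha> + 1)) * indicator {0..t} s
      \<le> ?k (t - s) * indicator {0..t} s"
    proof (cases "0 \<le> s \<and> s < t")
      case True
      define r where "r = t - s"
      have r: "0 < r" using True by (simp add: r_def)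
      have "norm (D t - D s) / r powr (\<alpha> + 1) \<le> (A * min r (1 / l) + K * r powr \<kappa>) / r powr (\<alpha> + 1)"
        using D[of s] True by (intro divide_right_mono) (auto simp: r_def)
      also have "\<dots> = A * (min r (1 / l) / r powr (\<alpha> + 1)) + K * (r powr \<kappa> / r powr (\<alpha> + 1))"
        by (simp add: add_divide_distrib)
      also have "r powr \<kappa> / r powr (\<alpha> + 1) = r powr ((\<kappa> - \<alpha>) - 1)"
        by (simp add: powr_diff[symmetric] algebra_simps)
      finally show ?thesis
        using True r assms
        by (simp add: r_def[symmetric] ennreal_mult[symmetric] ennreal_plus[symmetric] ennreal_leI del: ennreal_plus)
    qed (auto split: split_indicator)
  qed
  also have "\<dots> = (\<integral>\<^sup>+r\<in>{0..t}. ?k r \<partial>lborel)"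
    by (rule nn_integral_reflect_Icc[of ?k]) measurable
  also have "\<dots> = (\<integral>\<^sup>+r. ennreal A * (ennreal (min r (1 / l) / r powr (\<alpha> + 1)) * indicator {0..t} r)
      + ennreal K * (ennreal (r powr ((\<kappa> - \<alpha>) - 1)) * indicator {0..t} r) \<partial>lborel)"
    by (intro nn_integral_cong) (simp add: distrib_right mult.assoc)
  also have "\<dots> = ennreal A * (\<integral>\<^sup>+r\<in>{0..t}. ennreal (min r (1 / l) / r powr (\<alpha> + 1)) \<partial>lborel)
      + ennreal K * (\<integral>\<^sup>+r\<in>{0..t}. ennreal (r powr ((\<kappa> - \<alpha>) - 1)) \<partial>lborel)"
    by (simp add: nn_integral_add nn_integral_cmult)
  also have "\<dots> \<le> ennreal A * ennreal ((1 / (1 - \<alpha>) + 1 / \<alpha>) * l powr (\<alpha> - 1))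
      + ennreal K * ennreal (t powr (\<kappa> - \<alpha>) / (\<kappa> - \<alpha>))"
    using assms nn_integral_powr_Icc_0[of "\<kappa> - \<alpha>" t]
    by (intro add_mono mult_left_mono nn_integral_min_kernel_le) auto
  also have "\<dots> = ennreal (A * ((1 / (1 - \<alpha>) + 1 / \<alpha>) * l powr (\<alpha> - 1)) + K * (t powr (\<kappa> - \<alpha>) / (\<kappa> - \<alpha>)))"
    using assms by (simp add: ennreal_mult[symmetric] ennreal_plus[symmetric] del: ennreal_plus)
  finally show ?thesis .
qed

text \<open>
  The coefficient \<open>K\<close> may depend on \<open>t\<close>: it is constant in the growth estimate, but grows like
  \<open>exp (l * t)\<close> in the Lipschitz estimate, where the weight cancels it. Taking \<open>s = 0\<close> in the
  hypothesis bounds \<open>D t\<close> itself, so that increments control the whole norm.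
\<close>

lemma alpha_norm_le_of_increments:
  fixes D :: "real \<Rightarrow> 'a::real_normed_vector"
  assumes \<alpha>: "0 < \<alpha>" "\<alpha> < 1" and \<kappa>: "\<alpha> < \<kappa>" and l: "1 \<le> l" and A: "0 \<le> A"
    and K: "\<And>t. 0 \<le> K t" and D0: "D 0 = 0"
    and D: "\<And>s t. 0 \<le> s \<Longrightarrow> s \<le> t \<Longrightarrow> t \<le> T \<Longrightarrow>
      norm (D t - D s) \<le> A * exp (l * t) * min (t - s) (1 / l) + K t * (t - s) powr \<kappa>"
    and R: "\<And>t. 0 \<le> t \<Longrightarrow> t \<le> T \<Longrightarrow>
      exp (- l * t) * (K t * (t powr \<kappa> + t powr (\<kappa> - \<alpha>) / (\<kappa> - \<alpha>))) \<le> R"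
  shows "alpha_norm T \<alpha> l D \<le> ennreal (A * (1 + 1 / (1 - \<alpha>) + 1 / \<alpha>) * l powr (\<alpha> - 1) + R)"
  unfolding alpha_norm_def
proof (rule SUP_least)
  fix t assume "t \<in> {0..T}"
  then have t: "0 \<le> t" "t \<le> T" by auto
  let ?c = "1 / (1 - \<alpha>) + 1 / \<alpha>"
  let ?f = "A * exp (l * t) * (?c * l powr (\<alpha> - 1)) + K t * (t powr (\<kappa> - \<alpha>) / (\<kappa> - \<alpha>))"
  let ?n = "A * exp (l * t) * (1 / l) + K t * t powr \<kappa>"
  have f: "frac_int \<alpha> D t \<le> ennreal ?f"
    using D t assms by (intro frac_int_le) auto
  have "norm (D t) \<le> A * exp (l * t) * min t (1 / l) + K t * t powr \<kappa>"
    using D[of 0 t] t D0 by simp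
  also have "\<dots> \<le> ?n" using A by (intro add_right_mono mult_left_mono) auto
  finally have n: "norm (D t) \<le> ?n" .
  have f0: "0 \<le> ?f" using assms by simp
  have n0: "0 \<le> ?n" using assms by simp
  have "ennreal (exp (- l * t)) * (ennreal (norm (D t)) + frac_int \<alpha> D t)
     \<le> ennreal (exp (- l * t)) * (ennreal ?n + ennreal ?f)"
    using f n by (intro mult_left_mono add_mono ennreal_leI) auto
  also have "\<dots> = ennreal (exp (- l * t) * (?n + ?f))"
    using f0 n0 by (simp add: ennreal_mult ennreal_plus[symmetric] del: ennreal_plus)
  also have "exp (- l * t) * (?n + ?f) = A * (1 / l + ?c * l powr (\<alpha> - 1))
     + exp (- l * t) * (K t * (t powr \<kappa> + t powr (\<kappa> - \<alpha>) / (\<kappa> - \<alpha>)))"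
  proof -
    have e: "exp (- l * t) * exp (l * t) = 1" by (simp add: exp_add[symmetric])
    have "exp (- l * t) * (?n + ?f) = (exp (- l * t) * exp (l * t)) * (A * (1 / l + ?c * l powr (\<alpha> - 1)))
      + exp (- l * t) * (K t * (t powr \<kappa> + t powr (\<kappa> - \<alpha>) / (\<kappa> - \<alpha>)))"
      by (simp only: distrib_left distrib_right mult.assoc mult.left_commute add_ac) 
    then show ?thesis by (simp only: e mult_1_left)
  qed
  also have "\<dots> \<le> A * (1 + 1 / (1 - \<alpha>) + 1 / \<alpha>) * l powr (\<alpha> - 1) + R"
  proof -
    have "l powr (- 1) \<le> l powr (\<alpha> - 1)" using l \<alpha> by (intro powr_mono) auto
    then have "1 / l \<le> l powr (\<alpha> - 1)" using l by (simp add: powr_minus divide_inverse)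
    then have "1 / l + ?c * l powr (\<alpha> - 1) \<le> (1 + 1 / (1 - \<alpha>) + 1 / \<alpha>) * l powr (\<alpha> - 1)"
      by (simp add: distrib_right)
    then have "A * (1 / l + ?c * l powr (\<alpha> - 1)) \<le> A * (1 + 1 / (1 - \<alpha>) + 1 / \<alpha>) * l powr (\<alpha> - 1)"
      using A by (simp only: mult.assoc mult_left_mono)
    then show ?thesis using R[OF t] by linarith
  qed
  finally show "ennreal (exp (- l * t)) * (ennreal (norm (D t)) + frac_int \<alpha> D t)
     \<le> ennreal (A * (1 + 1 / (1 - \<alpha>) + 1 / \<alpha>) * l powr (\<alpha> - 1) + R)"
    by (simp add: ennreal_leI)
qed

lemma norm_le_exp_of_alpha_norm:
  assumes "alpha_norm T \<alpha> l f < \<infinity>"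
  obtains M where "0 \<le> M" "alpha_norm T \<alpha> l f = ennreal M"
    "\<And>u. u \<in> {0..T} \<Longrightarrow> norm (f u) \<le> M * exp (l * u)"
proof
  let ?M = "enn2real (alpha_norm T \<alpha> l f)"
  show "0 \<le> ?M" by simp
  show M: "alpha_norm T \<alpha> l f = ennreal ?M" using assms by simp
  show "norm (f u) \<le> ?M * exp (l * u)" if "u \<in> {0..T}" for u
  proof -
    have "ennreal (exp (- l * u) * norm (f u)) \<le> ennreal (exp (- l * u)) * (ennreal (norm (f u)) + frac_int \<alpha> f u)"
      by (simp add: ennreal_mult mult_left_mono)
    also have "\<dots> \<le> alpha_norm T \<alpha> l f"
      unfolding alpha_norm_def using that by (rule SUP_upper)
    finally have "exp (- l * u) * norm (f u) \<le> ?M" by (subst (asm) M) simp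
    then show ?thesis by (simp add: exp_minus field_simps)
  qed
qed

lemma W0_space_bounded:
  assumes "f \<in> W0_space T \<alpha>"
  obtains S where "0 \<le> S" "sup_norm T f = ennreal S" "\<And>u. u \<in> {0..T} \<Longrightarrow> norm (f u) \<le> S"
proof
  let ?S = "enn2real (sup_norm T f)"
  show "0 \<le> ?S" by simp
  have "sup_norm T f \<le> (SUP t\<in>{0..T}. ennreal (norm (f t)) + frac_int \<alpha> f t)"
    unfolding sup_norm_def by (intro SUP_mono') simp
  also have "\<dots> < \<infinity>" using assms by (simp add: W0_space_def)
  finally show S: "sup_norm T f = ennreal ?S" by simp
  show "norm (f u) \<le> ?S" if "u \<in> {0..T}" for u
  proof -
    have "ennreal (norm (f u)) \<le> sup_norm T f" unfolding sup_norm_def using that by (rule SUP_upper)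
    then show ?thesis by (subst (asm) S) simp
  qed
qed

lemma hoelder_norm_le_of_increments:
  fixes D :: "real \<Rightarrow> 'a::real_normed_vector"
  assumes "0 < \<kappa>" "0 \<le> C" "0 < T" "D 0 = 0"
    and D: "\<And>s t. 0 \<le> s \<Longrightarrow> s \<le> t \<Longrightarrow> t \<le> T \<Longrightarrow> norm (D t - D s) \<le> C * (t - s) powr \<kappa>"
  shows "hoelder_norm T \<kappa> D \<le> ennreal (C * (1 + T powr \<kappa>))"
proof -
  have "sup_norm T D \<le> ennreal (C * T powr \<kappa>)"
    unfolding sup_norm_def
  proof (intro SUP_least ennreal_leI)
    fix t assume "t \<in> {0..T}"
    then have t: "0 \<le> t" "t \<le> T" by auto
    have "norm (D t) \<le> C * t powr \<kappa>" using D[of 0 t] t assms by simp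
    also have "\<dots> \<le> C * T powr \<kappa>" using t assms by (intro mult_left_mono powr_mono2) auto
    finally show "norm (D t) \<le> C * T powr \<kappa>" .
  qed
  moreover have "(SUP (s, t)\<in>{(s, t). 0 \<le> s \<and> s < t \<and> t \<le> T}. ennreal (norm (D t - D s) / (t - s) powr \<kappa>))
    \<le> ennreal C"
    using D by (intro SUP_least) (auto intro!: ennreal_leI simp: divide_le_eq)
  ultimately have "hoelder_norm T \<kappa> D \<le> ennreal (C * T powr \<kappa>) + ennreal C"
    unfolding hoelder_norm_def by (rule add_mono)
  also have "\<dots> = ennreal (C * (1 + T powr \<kappa>))"
    using assms by (simp add: ennreal_plus[symmetric] algebra_simps del: ennreal_plus)
  finally show ?thesis .
qed

section \<open>Volterra integrals and sections of the dominating function\<close>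

text \<open>
  The kernel is kept abstract because it is \<open>b t u (f u)\<close> for the growth estimates and
  \<open>b t u (f u) - b t u (h u)\<close> for the Lipschitz estimate.
\<close>

lemma norm_volterra_increment_le:
  fixes k :: "real \<Rightarrow> real \<Rightarrow> 'a::euclidean_space"
  assumes st: "0 \<le> s" "s \<le> t"
    and kt: "set_integrable lebesgue {0..t} (k t)"
    and ks: "set_integrable lebesgue {0..s} (k s)"
  shows "ennreal (norm ((LINT u:{0..t}|lebesgue. k t u) - (LINT u:{0..s}|lebesgue. k s u)))
    \<le> (\<integral>\<^sup>+u\<in>{s..t}. ennreal (norm (k t u)) \<partial>lebesgue)
      + (\<integral>\<^sup>+u\<in>{0..s}. ennreal (norm (k t u - k s u)) \<partial>lebesgue)"
proof -
  have bound: "ennreal (norm (LINT u:A|lebesgue. g u)) \<le> (\<integral>\<^sup>+u\<in>A. ennreal (norm (g u)) \<partial>lebesgue)"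
    if "set_integrable lebesgue A g" for A and g :: "real \<Rightarrow> 'a"
  proof -
    have "ennreal (norm (LINT u:A|lebesgue. g u))
      \<le> (\<integral>\<^sup>+u. ennreal (norm (indicator A u *\<^sub>R g u)) \<partial>lebesgue)"
      using that unfolding set_lebesgue_integral_def set_integrable_def
      by (rule integral_norm_bound_ennreal)
    also have "\<dots> = (\<integral>\<^sup>+u\<in>A. ennreal (norm (g u)) \<partial>lebesgue)"
      by (intro nn_integral_cong) (auto split: split_indicator)
    finally show ?thesis .
  qed
  have kt1: "set_integrable lebesgue {0..s} (k t)" and kt2: "set_integrable lebesgue {s<..t} (k t)"
    using kt st by (auto intro: set_integrable_subset)
  have "{0..t} = {0..s} \<union> {s<..t}" using st by auto
  then have "(LINT u:{0..t}|lebesgue. k t u)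
      = (LINT u:{0..s}|lebesgue. k t u) + (LINT u:{s<..t}|lebesgue. k t u)"
    using set_integral_Un[OF _ kt1 kt2] by (simp add: ivl_disj_int)
  then have "(LINT u:{0..t}|lebesgue. k t u) - (LINT u:{0..s}|lebesgue. k s u)
      = (LINT u:{s<..t}|lebesgue. k t u) + (LINT u:{0..s}|lebesgue. k t u - k s u)"
    using kt1 ks by simp
  then have "ennreal (norm ((LINT u:{0..t}|lebesgue. k t u) - (LINT u:{0..s}|lebesgue. k s u)))
     \<le> ennreal (norm (LINT u:{s<..t}|lebesgue. k t u))
       + ennreal (norm (LINT u:{0..s}|lebesgue. k t u - k s u))"
    by (simp add: ennreal_plus[symmetric] norm_triangle_ineq ennreal_leI del: ennreal_plus)
  also have "\<dots> \<le> (\<integral>\<^sup>+u\<in>{s<..t}. ennreal (norm (k t u)) \<partial>lebesgue)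
      + (\<integral>\<^sup>+u\<in>{0..s}. ennreal (norm (k t u - k s u)) \<partial>lebesgue)"
    using kt1 kt2 ks by (intro add_mono bound) (auto intro: set_integral_diff)
  also have "\<dots> \<le> (\<integral>\<^sup>+u\<in>{s..t}. ennreal (norm (k t u)) \<partial>lebesgue)
      + (\<integral>\<^sup>+u\<in>{0..s}. ennreal (norm (k t u - k s u)) \<partial>lebesgue)"
    by (intro add_right_mono nn_set_integral_set_mono) auto
  finally show ?thesis .
qed

text \<open>
  If no section had a moment below the mean plus \<open>1\<close>, the double integral would be at least \<open>T\<close> larger
  than it is. The \<open>1\<close> leaves room for discarding the null set of \<open>r\<close> whose sections are badly behaved:
  Lebesgue measurability on the square controls only almost every section, so the argument passes to a
  Borel function that agrees with \<open>b0\<close> almost everywhere.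
\<close>

lemma obtain_Lp_section:
  fixes b0 :: "real \<Rightarrow> real \<Rightarrow> real" and p T :: real
  assumes T: "0 < T"
    and meas: "(\<lambda>(t, s). b0 t s) \<in> borel_measurable (lebesgue_on ({0..T} \<times> {0..T}))"
    and int: "integrable (lebesgue_on ({0..T} \<times> {0..T})) (\<lambda>(t, s). b0 t s powr p)"
  obtains r where "r \<in> {0..T}" "b0 r \<in> borel_measurable (lebesgue_on {0..T})"
    "(\<integral>\<^sup>+s\<in>{0..T}. ennreal (b0 r s powr p) \<partial>lebesgue)
      \<le> ennreal ((LINT (t, s)|lebesgue_on ({0..T} \<times> {0..T}). b0 t s powr p) / T + 1)"
proof -
  let ?Q = "{0..T} \<times> {0..T}"
  define I where "I = (LINT (t, s)|lebesgue_on ?Q. b0 t s powr p)"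
  define h where "h z = (if z \<in> ?Q then (\<lambda>(t, s). b0 t s) z else 0)" for z
  have Q: "?Q \<in> sets lebesgue"
    by (intro lmeasurable_cbox sets_completionI_sets) (auto simp: borel_Times)
  have I0: "0 \<le> I" unfolding I_def by (intro integral_nonneg_AE) auto
  have "h \<in> borel_measurable lebesgue"
    unfolding h_def using borel_measurable_if_I[OF meas Q] by simp
  then obtain g where g: "g \<in> borel_measurable lborel" and hg: "AE z in lborel. h z = g z"
    using completion_ex_borel_measurable_real by blast
  define G where "G t = (\<integral>\<^sup>+s. ennreal (g (t, s) powr p) \<partial>lborel)" for t
  have gm[measurable]: "g \<in> borel_measurable (lborel \<Otimes>\<^sub>M lborel)"
    using g by (simp add: lborel_prod)
  have "(\<integral>\<^sup>+t. G t \<partial>lborel) = (\<integral>\<^sup>+z. ennreal (g z powr p) \<partial>(lborel \<Otimes>\<^sub>M lborel))"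
    unfolding G_def by (intro lborel.nn_integral_fst) measurable
  also have "\<dots> = (\<integral>\<^sup>+z. ennreal (h z powr p) \<partial>lborel)"
    unfolding lborel_prod using hg by (intro nn_integral_cong_AE) auto
  also have "\<dots> = (\<integral>\<^sup>+z. ennreal (h z powr p) \<partial>lebesgue)"
    by (simp add: nn_integral_completion)
  also have "\<dots> = (\<integral>\<^sup>+z\<in>?Q. ennreal ((\<lambda>(t, s). b0 t s powr p) z) \<partial>lebesgue)"
    by (intro nn_integral_cong) (auto simp: h_def split: split_indicator)
  also have "\<dots> = (\<integral>\<^sup>+z. ennreal ((\<lambda>(t, s). b0 t s powr p) z) \<partial>lebesgue_on ?Q)"
    using Q by (subst nn_integral_restrict_space) auto
  also have "\<dots> = ennreal I"
    unfolding I_def by (intro nn_integral_eq_integral int) auto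
  finally have GI: "(\<integral>\<^sup>+t. G t \<partial>lborel) = ennreal I" .
  have ae: "AE t in lborel. AE s in lborel. h (t, s) = g (t, s)"
  proof (rule lborel_pair.AE_pair)
    show "AE z in lborel \<Otimes>\<^sub>M (lborel :: real measure). h z = g z"
      using hg unfolding lborel_prod .
  qed
  have "\<exists>r\<in>{0..T}. (AE s in lborel. h (r, s) = g (r, s)) \<and> G r \<le> ennreal (I / T + 1)"
  proof (rule ccontr)
    assume "\<not> ?thesis"
    then have "AE t in lborel. ennreal (I / T + 1) * indicator {0..T} t \<le> G t"
      using ae by (auto split: split_indicator elim!: eventually_mono) 
    then have "(\<integral>\<^sup>+t. ennreal (I / T + 1) * indicator {0..T} t \<partial>lborel) \<le> (\<integral>\<^sup>+t. G t \<partial>lborel)"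
      by (rule nn_integral_mono_AE)
    then have "ennreal (I / T + 1) * ennreal T \<le> ennreal I"
      using T by (simp add: GI nn_integral_cmult_indicator)
    then have "(I / T + 1) * T \<le> I"
      using T I0 by (simp add: ennreal_mult[symmetric] del: ennreal_plus)
    moreover have "(I / T + 1) * T = I + T" using T by (simp add: field_simps)
    ultimately show False using T by linarith
  qed
  then obtain r where r: "r \<in> {0..T}" and hgr: "AE s in lborel. h (r, s) = g (r, s)"
    and Gr: "G r \<le> ennreal (I / T + 1)" by blast
  have "(\<lambda>s. g (r, s)) \<in> borel_measurable lebesgue"
    using measurable_Pair2[OF gm, of r] by (intro measurable_completion) simp
  then have "(\<lambda>s. h (r, s)) \<in> borel_measurable lebesgue"
    by (rule borel_measurable_AE) (use hgr in \<open>auto simp: AE_completion_iff\<close>)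
  moreover have "(\<lambda>s. h (r, s)) = (\<lambda>s. if s \<in> {0..T} then b0 r s else 0)"
    using r by (auto simp: h_def fun_eq_iff)
  ultimately have "b0 r \<in> borel_measurable (lebesgue_on {0..T})"
    by (intro borel_measurable_if_D) (simp only:)
  moreover have "(\<integral>\<^sup>+s\<in>{0..T}. ennreal (b0 r s powr p) \<partial>lebesgue) \<le> ennreal (I / T + 1)"
  proof -
    have "(\<integral>\<^sup>+s\<in>{0..T}. ennreal (b0 r s powr p) \<partial>lebesgue) = (\<integral>\<^sup>+s. ennreal (h (r, s) powr p) \<partial>lborel)"
      using r unfolding nn_integral_completion
      by (intro nn_integral_cong) (auto simp: h_def split: split_indicator)
    also have "\<dots> = G r"
      unfolding G_def using hgr by (intro nn_integral_cong_AE) auto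
    finally show ?thesis using Gr by simp
  qed
  ultimately show thesis using that r unfolding I_def by blast
qed

text \<open>
  This is Hoelder's inequality with exponent \<open>1 / \<alpha>\<close> up to the constant: integrate \<open>le_powr_split\<close>
  over the interval, with \<open>r\<close> its length \<open>t - s\<close>.
\<close>

lemma nn_integral_Icc_le_of_powr:
  fixes w :: "real \<Rightarrow> real" and \<alpha> B T s t :: real
  assumes \<alpha>: "0 < \<alpha>" "\<alpha> < 1" and st: "0 \<le> s" "s \<le> t" "t \<le> T" and B: "0 \<le> B"
    and w0: "\<And>u. u \<in> {0..T} \<Longrightarrow> 0 \<le> w u"
    and wm: "w \<in> borel_measurable (lebesgue_on {0..T})"
    and wB: "(\<integral>\<^sup>+u\<in>{0..T}. ennreal (w u powr (1 / \<alpha>)) \<partial>lebesgue) \<le> ennreal B"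
  shows "(\<integral>\<^sup>+u\<in>{s..t}. ennreal (w u) \<partial>lebesgue) \<le> ennreal ((1 + B) * (t - s) powr (1 - \<alpha>))"
proof (cases "s = t")
  case True
  have "(\<integral>\<^sup>+u\<in>{t..t}. ennreal (w u) \<partial>lebesgue) = 0"
    by (intro nn_integral_null_set) (simp add: null_sets_completionI)
  then show ?thesis using True by simp
next
  case False
  with st have r: "0 < t - s" by simp
  define r where "r = t - s"
  have [measurable]: "w \<in> borel_measurable (lebesgue_on {s..t})"
    using measurable_restrict_mono[OF wm] st by auto
  have e: "emeasure (lebesgue_on {s..t})  {s..t} = ennreal r"
    using st by (simp add: emeasure_restrict_space r_def)
  have "(\<integral>\<^sup>+u\<in>{s..t}. ennreal (w u) \<partial>lebesgue) = (\<integral>\<^sup>+u. ennreal (w u) \<partial>lebesgue_on {s..t})"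
    by (subst nn_integral_restrict_space) auto
  also have "\<dots> \<le> (\<integral>\<^sup>+u. ennreal (r powr - \<alpha>) + ennreal (r powr (1 - \<alpha>)) * ennreal (w u powr (1 / \<alpha>)) \<partial>lebesgue_on {s..t})"
  proof (rule nn_integral_mono)
    fix u assume "u \<in> space (lebesgue_on {s..t})"
    then have "0 \<le> w u" using w0 st by simp
    from le_powr_split[OF this _ \<alpha>, of r] r
    show "ennreal (w u) \<le> ennreal (r powr - \<alpha>) + ennreal (r powr (1 - \<alpha>)) * ennreal (w u powr (1 / \<alpha>))"
      by (simp add: r_def ennreal_mult[symmetric] ennreal_plus[symmetric] ennreal_leI del: ennreal_plus)
  qed
  also have "\<dots> = ennreal (r powr - \<alpha>) * ennreal r
      + ennreal (r powr (1 - \<alpha>)) * (\<integral>\<^sup>+u. ennreal (w u powr (1 / \<alpha>)) \<partial>lebesgue_on {s..t})"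
    by (simp add: nn_integral_add nn_integral_cmult e)
  also have "(\<integral>\<^sup>+u. ennreal (w u powr (1 / \<alpha>)) \<partial>lebesgue_on {s..t})
      = (\<integral>\<^sup>+u\<in>{s..t}. ennreal (w u powr (1 / \<alpha>)) \<partial>lebesgue)"
    by (subst nn_integral_restrict_space) auto
  also have "\<dots> \<le> (\<integral>\<^sup>+u\<in>{0..T}. ennreal (w u powr (1 / \<alpha>)) \<partial>lebesgue)"
    using st by (intro nn_set_integral_set_mono) auto
  also have "\<dots> \<le> ennreal B" by (rule wB)
  also have "ennreal (r powr - \<alpha>) * ennreal r + ennreal (r powr (1 - \<alpha>)) * ennreal B
      = ennreal ((1 + B) * (t - s) powr (1 - \<alpha>))"
    using r B unfolding r_def[symmetric]
    by (simp add: ennreal_mult[symmetric] ennreal_plus[symmetric] powr_diff powr_minus field_simps del: ennreal_plus)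
  finally show ?thesis by (simp add: mult_left_mono add_left_mono)
qed

section \<open>Estimates for the integral operator\<close>

lemma H2_measurable_compose:
  assumes H: "H2 T b \<rho> b0 \<mu> L L0 LN" and f: "f \<in> borel_measurable (lebesgue_on {0..T})"
    and t: "t \<in> {0..T}"
  shows "(\<lambda>s. b t s (f s)) \<in> borel_measurable (lebesgue_on {0..T})"
proof -
  have b: "(\<lambda>(t, s, x). b t s x) \<in> borel_measurable (restrict_space borel ({0..T} \<times> {0..T} \<times> UNIV))"
    using H by (simp add: H2_def)
  have "(\<lambda>s. (t, s, f s)) \<in> lebesgue_on {0..T} \<rightarrow>\<^sub>M restrict_space borel ({0..T} \<times> {0..T} \<times> UNIV)"
  proof (rule measurable_restrict_space2)
    show "(\<lambda>s. (t, s, f s)) \<in> borel_measurable (lebesgue_on {0..T})"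
      using f id_borel_measurable_lebesgue_on[of "{0..T}"]
      by (intro borel_measurable_Pair) (auto simp: id_def)
  qed (use t in auto)
  from measurable_compose[OF this b] show ?thesis by simp
qed

text \<open>
  Comparing the times \<open>t\<close> and \<open>r\<close> moves the integrability requirement from the section of \<open>b0\<close> at \<open>t\<close>
  to the one at \<open>r\<close>, which may be chosen once for all \<open>t\<close>.
\<close>

lemma H2_growth:
  assumes H: "H2 T b \<rho> b0 \<mu> L L0 LN" and "r \<in> {0..T}" "t \<in> {0..T}" "s \<in> {0..T}"
  shows "norm (b t s x) \<le> L0 * norm x + (L * T powr \<mu> + b0 r s)"
proof -
  have "norm (b t s x) \<le> norm (b t s x - b r s x) + norm (b r s x)"
    by (metis add.commute diff_add_cancel norm_triangle_ineq)
  also have "norm (b r s x) \<le> L0 * norm x + b0 r s"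
    using assms by (simp add: H2_def)
  also have "norm (b t s x - b r s x) \<le> L * \<bar>t - r\<bar> powr \<mu>"
    using assms by (simp add: H2_def)
  also have "\<dots> \<le> L * T powr \<mu>"
    using assms by (intro mult_left_mono powr_mono2) (auto simp: H2_def)
  finally show ?thesis by simp
qed

text \<open>
  The constants are explicit functions of the parameters on which they may depend, which makes this
  dependence visible. The bound \<open>B\<close> for the moment of the chosen section is \<open>moment_const \<alpha> T b0\<close>, and
  \<open>increment_const\<close> is the coefficient of \<open>(t - s) powr (1 - \<alpha>)\<close> in the increments of \<^const>\<open>F_op\<close>.
  One \<open>L * T powr (\<mu> + \<alpha>)\<close> pays for comparing the times \<open>t\<close> and \<open>r\<close>, the other for the change of the
  kernel between \<open>s\<close> and \<open>t\<close>, and \<open>1 + B\<close> comes from the section.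
\<close>

definition increment_const :: "real \<Rightarrow> real \<Rightarrow> real \<Rightarrow> real \<Rightarrow> real \<Rightarrow> real" where
  "increment_const \<mu> \<alpha> T L B = 2 * L * T powr (\<mu> + \<alpha>) + 1 + B"

definition hoelder_const :: "real \<Rightarrow> real \<Rightarrow> real \<Rightarrow> real \<Rightarrow> real \<Rightarrow> real \<Rightarrow> real" where
  "hoelder_const \<mu> \<alpha> T L L0 B
    = (L0 * T powr \<alpha> + increment_const \<mu> \<alpha> T L B) * (1 + T powr (1 - \<alpha>))"

definition growth_const :: "real \<Rightarrow> real \<Rightarrow> real \<Rightarrow> real \<Rightarrow> real \<Rightarrow> real \<Rightarrow> real" where
  "growth_const \<mu> \<alpha> T L L0 B
    = L0 * (1 + 1 / (1 - \<alpha>) + 1 / \<alpha>) + increment_const \<mu> \<alpha> T L B * (1 + 1 / (1 - 2 * \<alpha>))"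

definition lipschitz_const :: "real \<Rightarrow> real \<Rightarrow> real \<Rightarrow> real" where
  "lipschitz_const \<alpha> T c
    = c * (1 + 1 / (1 - \<alpha>) + 1 / \<alpha> + T + T powr (1 - \<alpha>) / (1 - \<alpha>))"

definition moment_const :: "real \<Rightarrow> real \<Rightarrow> (real \<Rightarrow> real \<Rightarrow> real) \<Rightarrow> real" where
  "moment_const \<alpha> T b0
    = (LINT (t, s)|lebesgue_on ({0..T} \<times> {0..T}). b0 t s powr (1 / \<alpha>)) / T + 1"

text \<open>
  The parameter \<open>r\<close> is the time whose section \<open>b0 r\<close> dominates the growth of the kernel at every
  time, and \<open>B\<close> bounds its moment.
\<close>

locale H2_kernel =
  fixes T \<alpha> \<mu> L L0 B r :: real and LN :: "real \<Rightarrow> real" and b0 :: "real \<Rightarrow> real \<Rightarrow> real"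
    and b :: "real \<Rightarrow> real \<Rightarrow> real ^ 'n \<Rightarrow> real ^ 'n"
  assumes T: "0 < T" and \<alpha>: "0 < \<alpha>" "\<alpha> < 1 / 2" and \<mu>: "1 - \<alpha> < \<mu>"
    and H: "H2 T b (1 / \<alpha>) b0 \<mu> L L0 LN"
    and r: "r \<in> {0..T}" and section_measurable: "b0 r \<in> borel_measurable (lebesgue_on {0..T})"
    and B: "0 \<le> B"
    and section_bound: "(\<integral>\<^sup>+s\<in>{0..T}. ennreal (b0 r s powr (1 / \<alpha>)) \<partial>lebesgue) \<le> ennreal B"
begin

abbreviation K :: real where "K \<equiv> increment_const \<mu> \<alpha> T L B"

lemma L_pos: "0 < L" and L0_pos: "0 < L0" and LN_pos: "0 \<le> N \<Longrightarrow> 0 < LN N"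
  using H by (auto simp: H2_def)

lemma K_pos: "0 < K"
  unfolding increment_const_def using L_pos B T by (intro add_nonneg_pos add_pos_nonneg) auto

lemma hoelder_const_pos: "0 < hoelder_const \<mu> \<alpha> T L L0 B"
  unfolding hoelder_const_def using L0_pos K_pos
  by (intro mult_pos_pos add_nonneg_pos add_pos_nonneg) auto

lemma growth_const_pos: "0 < growth_const \<mu> \<alpha> T L L0 B"
  unfolding growth_const_def using L0_pos K_pos \<alpha>
  by (intro add_pos_pos mult_pos_pos add_pos_pos divide_pos_pos) auto

lemma lipschitz_const_pos: "0 \<le> N \<Longrightarrow> 0 < lipschitz_const \<alpha> T (LN N)"
  unfolding lipschitz_const_def using LN_pos[of N] T \<alpha>
  by (intro mult_pos_pos add_pos_nonneg add_pos_pos divide_pos_pos) auto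

lemma section_nonneg: "u \<in> {0..T} \<Longrightarrow> 0 \<le> b0 r u"
  using H r by (auto simp: H2_def)

lemma section_integral_le:
  assumes "0 \<le> s" "s \<le> t" "t \<le> T"
  shows "(\<integral>\<^sup>+u\<in>{s..t}. ennreal (b0 r u) \<partial>lebesgue) \<le> ennreal ((1 + B) * (t - s) powr (1 - \<alpha>))"
  using assms \<alpha> B section_nonneg section_measurable section_bound
  by (intro nn_integral_Icc_le_of_powr) auto

lemma nn_integral_kernel_le:
  fixes f :: "real \<Rightarrow> real ^ 'n"
  assumes f: "f \<in> borel_measurable (lebesgue_on {0..T})" and st: "0 \<le> s" "s \<le> t" "t \<le> T"
  shows "(\<integral>\<^sup>+u\<in>{s..t}. ennreal (norm (b t u (f u))) \<partial>lebesgue)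
    \<le> ennreal L0 * (\<integral>\<^sup>+u\<in>{s..t}. ennreal (norm (f u)) \<partial>lebesgue)
      + ennreal (L * T powr \<mu> * (t - s) + (1 + B) * (t - s) powr (1 - \<alpha>))"
proof -
  have sub: "{s..t} \<subseteq> {0..T}" using st by auto
  have [measurable]: "f \<in> borel_measurable (lebesgue_on {s..t})"
    "b0 r \<in> borel_measurable (lebesgue_on {s..t})"
    using f section_measurable sub by (auto intro: measurable_restrict_mono)
  have e: "emeasure (lebesgue_on {s..t}) {s..t} = ennreal (t - s)"
    using st by (simp add: emeasure_restrict_space)
  have on: "(\<integral>\<^sup>+u\<in>{s..t}. g u \<partial>lebesgue) = (\<integral>\<^sup>+u. g u \<partial>lebesgue_on {s..t})" for g
    by (subst nn_integral_restrict_space) auto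
  have "(\<integral>\<^sup>+u\<in>{s..t}. ennreal (norm (b t u (f u))) \<partial>lebesgue)
    \<le> (\<integral>\<^sup>+u. ennreal L0 * ennreal (norm (f u)) + (ennreal (L * T powr \<mu>) + ennreal (b0 r u)) \<partial>lebesgue_on {s..t})"
    unfolding on
  proof (rule nn_integral_mono)
    fix u assume "u \<in> space (lebesgue_on {s..t})"
    then have u: "u \<in> {0..T}" using sub by auto
    from H2_growth[OF H r _ u, of t "f u"] st
    show "ennreal (norm (b t u (f u)))
      \<le> ennreal L0 * ennreal (norm (f u)) + (ennreal (L * T powr \<mu>) + ennreal (b0 r u))"
      using L0_pos L_pos section_nonneg[OF u]
      by (simp add: ennreal_mult[symmetric] ennreal_plus[symmetric] ennreal_leI del: ennreal_plus)
  qed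
  also have "\<dots> = ennreal L0 * (\<integral>\<^sup>+u. ennreal (norm (f u)) \<partial>lebesgue_on {s..t})
      + (ennreal (L * T powr \<mu>) * ennreal (t - s) + (\<integral>\<^sup>+u. ennreal (b0 r u) \<partial>lebesgue_on {s..t}))"
    by (simp add: nn_integral_add nn_integral_cmult e)
  also have "\<dots> \<le> ennreal L0 * (\<integral>\<^sup>+u\<in>{s..t}. ennreal (norm (f u)) \<partial>lebesgue)
      + (ennreal (L * T powr \<mu>) * ennreal (t - s) + ennreal ((1 + B) * (t - s) powr (1 - \<alpha>)))"
    unfolding on[symmetric] using section_integral_le[OF st] by (intro add_mono order_refl)
  also have "ennreal (L * T powr \<mu>) * ennreal (t - s) + ennreal ((1 + B) * (t - s) powr (1 - \<alpha>))
     = ennreal (L * T powr \<mu> * (t - s) + (1 + B) * (t - s) powr (1 - \<alpha>))"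
    using st L_pos B by (simp add: ennreal_mult ennreal_plus)
  finally show ?thesis .
qed

lemma kernel_set_integrable:
  fixes f :: "real \<Rightarrow> real ^ 'n"
  assumes f: "f \<in> borel_measurable (lebesgue_on {0..T})"
    and S: "\<And>u. u \<in> {0..T} \<Longrightarrow> norm (f u) \<le> S" and t: "t \<in> {0..T}"
  shows "set_integrable lebesgue {0..t} (\<lambda>u. b t u (f u))"
proof -
  have "(\<integral>\<^sup>+u\<in>{0..t}. ennreal (norm (f u)) \<partial>lebesgue) \<le> (\<integral>\<^sup>+u\<in>{0..t}. ennreal S \<partial>lebesgue)"
    using S t by (intro nn_integral_mono) (auto split: split_indicator intro!: ennreal_leI)
  also have "\<dots> < \<infinity>"
    using t by (subst nn_integral_cmult_indicator) (auto simp: ennreal_mult_less_top)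
  finally have fin: "ennreal L0 * (\<integral>\<^sup>+u\<in>{0..t}. ennreal (norm (f u)) \<partial>lebesgue) < \<infinity>"
    by (simp add: ennreal_mult_less_top)
  have "(\<integral>\<^sup>+u\<in>{0..t}. ennreal (norm (b t u (f u))) \<partial>lebesgue) < \<infinity>"
    using nn_integral_kernel_le[OF f, of 0 t] t fin
    by (auto simp: less_top[symmetric] top_unique)
  then have "(\<integral>\<^sup>+u. ennreal (norm (b t u (f u))) \<partial>lebesgue_on {0..t}) < \<infinity>"
    by (subst nn_integral_restrict_space) auto
  moreover have "(\<lambda>u. b t u (f u)) \<in> borel_measurable (lebesgue_on {0..t})"
    using measurable_restrict_mono[OF H2_measurable_compose[OF H f t]] t by auto
  ultimately have "integrable (lebesgue_on {0..t}) (\<lambda>u. b t u (f u))"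
    by (intro integrableI_bounded)
  then show ?thesis
    by (subst (asm) integrable_restrict_space) (auto simp: set_integrable_def)
qed

lemma F_op_0: "F_op b f 0 = 0"
  unfolding F_op_def set_lebesgue_integral_def
proof (rule integral_eq_zero_AE)
  have "{0::real} \<in> null_sets lebesgue" by (simp add: null_sets_completionI)
  then show "AE u in lebesgue. indicator {0..0} u *\<^sub>R b 0 u (f u) = 0"
    by (rule AE_I') (auto split: split_indicator)
qed

text \<open>
  The bound \<open>I\<close> for the integral of the norm of \<open>f\<close> is left open, to be taken from the supremum of
  \<open>f\<close> for the Hoelder norm and from an exponential envelope for the weighted norms.
\<close>

lemma F_op_increment_le:
  fixes f :: "real \<Rightarrow> real ^ 'n"
  assumes f: "f \<in> borel_measurable (lebesgue_on {0..T})"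
    and S: "\<And>u. u \<in> {0..T} \<Longrightarrow> norm (f u) \<le> S" and st: "0 \<le> s" "s \<le> t" "t \<le> T"
    and I: "(\<integral>\<^sup>+u\<in>{s..t}. ennreal (norm (f u)) \<partial>lebesgue) \<le> ennreal I" and I0: "0 \<le> I"
  shows "norm (F_op b f t - F_op b f s) \<le> L0 * I + K * (t - s) powr (1 - \<alpha>)"
proof -
  let ?d = "t - s"
  have d: "0 \<le> ?d" "?d \<le> T" using st by auto
  have "(\<integral>\<^sup>+u\<in>{0..s}. ennreal (norm (b t u (f u) - b s u (f u))) \<partial>lebesgue)
     \<le> (\<integral>\<^sup>+u\<in>{0..s}. ennreal (L * ?d powr \<mu>) \<partial>lebesgue)"
  proof (rule nn_integral_mono)
    fix u
    have "norm (b t u (f u) - b s u (f u)) \<le> L * \<bar>t - s\<bar> powr \<mu>" if "u \<in> {0..s}"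
    proof -
      have "t \<in> {0..T}" "s \<in> {0..T}" "u \<in> {0..T}" using that st by auto
      then show ?thesis using H unfolding H2_def by blast
    qed
    then show "ennreal (norm (b t u (f u) - b s u (f u))) * indicator {0..s} u
       \<le> ennreal (L * ?d powr \<mu>) * indicator {0..s} u"
      using d by (auto split: split_indicator intro!: ennreal_leI)
  qed
  also have "\<dots> = ennreal (L * ?d powr \<mu> * s)"
    using st L_pos by (subst nn_integral_cmult_indicator) (auto simp: ennreal_mult)
  finally have time: "(\<integral>\<^sup>+u\<in>{0..s}. ennreal (norm (b t u (f u) - b s u (f u))) \<partial>lebesgue)
     \<le> ennreal (L * ?d powr \<mu> * s)" .
  have "ennreal (norm (F_op b f t - F_op b f s))
    \<le> (\<integral>\<^sup>+u\<in>{s..t}. ennreal (norm (b t u (f u))) \<partial>lebesgue)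
      + (\<integral>\<^sup>+u\<in>{0..s}. ennreal (norm (b t u (f u) - b s u (f u))) \<partial>lebesgue)"
    unfolding F_op_def
    by (rule norm_volterra_increment_le[where k = "\<lambda>t u. b t u (f u)"])
       (use st kernel_set_integrable[OF f S] in auto)
  also have "\<dots> \<le> (ennreal L0 * ennreal I + ennreal (L * T powr \<mu> * ?d + (1 + B) * ?d powr (1 - \<alpha>)))
     + ennreal (L * ?d powr \<mu> * s)"
    by (intro add_mono time order_trans[OF nn_integral_kernel_le[OF f st]] mult_left_mono I) auto
  also have "\<dots> = ennreal (L0 * I + (L * T powr \<mu> * ?d + (1 + B) * ?d powr (1 - \<alpha>)) + L * ?d powr \<mu> * s)"
    using st L_pos L0_pos B I0
    by (simp add: ennreal_mult[symmetric] ennreal_plus[symmetric] del: ennreal_plus)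
  finally have "norm (F_op b f t - F_op b f s)
     \<le> L0 * I + (L * T powr \<mu> * ?d + (1 + B) * ?d powr (1 - \<alpha>)) + L * ?d powr \<mu> * s"
    by (rule ennreal_le_iff[THEN iffD1, rotated]) (use st L_pos L0_pos B I0 in auto)
  \<comment> \<open>Both remaining powers of \<open>t - s\<close> exceed \<open>1 - \<alpha>\<close>; the excess is bounded by a power of \<open>T\<close>.\<close>
  moreover have "L * T powr \<mu> * ?d \<le> L * T powr (\<mu> + \<alpha>) * ?d powr (1 - \<alpha>)"
  proof -
    have "?d = ?d powr \<alpha> * ?d powr (1 - \<alpha>)" using d by (simp add: powr_add[symmetric])
    also have "\<dots> \<le> T powr \<alpha> * ?d powr (1 - \<alpha>)"
      using d \<alpha> by (intro mult_right_mono powr_mono2) auto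
    finally have "L * T powr \<mu> * ?d \<le> L * T powr \<mu> * (T powr \<alpha> * ?d powr (1 - \<alpha>))"
      using L_pos by (intro mult_left_mono) auto
    then show ?thesis by (simp add: powr_add mult.assoc)
  qed
  moreover have "L * ?d powr \<mu> * s \<le> L * T powr (\<mu> + \<alpha>) * ?d powr (1 - \<alpha>)"
  proof -
    have "?d powr \<mu> = ?d powr (\<mu> + \<alpha> - 1) * ?d powr (1 - \<alpha>)" by (simp add: powr_add[symmetric])
    also have "\<dots> \<le> T powr (\<mu> + \<alpha> - 1) * ?d powr (1 - \<alpha>)"
      using d \<mu> by (intro mult_right_mono powr_mono2) auto
    finally have "?d powr \<mu> * s \<le> T powr (\<mu> + \<alpha> - 1) * ?d powr (1 - \<alpha>) * T"
      using st by (intro mult_mono) auto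
    also have "\<dots> = T powr (\<mu> + \<alpha>) * ?d powr (1 - \<alpha>)"
      using T by (simp add: powr_diff)
    finally show ?thesis using L_pos by (simp add: mult.assoc)
  qed
  ultimately show ?thesis unfolding increment_const_def by (simp add: algebra_simps)
qed

lemma hoelder_norm_F_op_le:
  fixes f :: "real \<Rightarrow> real ^ 'n"
  assumes f: "f \<in> borel_measurable (lebesgue_on {0..T})" and S0: "0 \<le> S"
    and S: "\<And>u. u \<in> {0..T} \<Longrightarrow> norm (f u) \<le> S"
  shows "hoelder_norm T (1 - \<alpha>) (F_op b f)
    \<le> ennreal (hoelder_const \<mu> \<alpha> T L L0 B * (1 + S))"
proof -
  let ?C = "L0 * S * T powr \<alpha> + K"
  have "hoelder_norm T (1 - \<alpha>) (F_op b f) \<le> ennreal (?C * (1 + T powr (1 - \<alpha>)))"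
  proof (rule hoelder_norm_le_of_increments)
    fix s t assume st: "0 \<le> s" "s \<le> t" "t \<le> T"
    have "(\<integral>\<^sup>+u\<in>{s..t}. ennreal (norm (f u)) \<partial>lebesgue) \<le> (\<integral>\<^sup>+u\<in>{s..t}. ennreal S \<partial>lebesgue)"
      using S st by (intro nn_integral_mono) (auto split: split_indicator intro!: ennreal_leI)
    also have "\<dots> = ennreal (S * (t - s))"
      using st S0 by (subst nn_integral_cmult_indicator) (auto simp: ennreal_mult)
    finally have "norm (F_op b f t - F_op b f s) \<le> L0 * (S * (t - s)) + K * (t - s) powr (1 - \<alpha>)"
      using F_op_increment_le[OF f S st] st S0 by simp
    also have "L0 * (S * (t - s)) \<le> L0 * (S * (T powr \<alpha> * (t - s) powr (1 - \<alpha>)))"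
    proof -
      have "t - s = (t - s) powr \<alpha> * (t - s) powr (1 - \<alpha>)"
        using st by (simp add: powr_add[symmetric])
      also have "\<dots> \<le> T powr \<alpha> * (t - s) powr (1 - \<alpha>)"
        using st \<alpha> by (intro mult_right_mono powr_mono2) auto
      finally show ?thesis using L0_pos S0 by (simp add: mult_left_mono)
    qed
    finally show "norm (F_op b f t - F_op b f s) \<le> ?C * (t - s) powr (1 - \<alpha>)"
      by (simp add: algebra_simps)
  qed (use \<alpha> T S0 L0_pos K_pos F_op_0 in auto)
  also have "\<dots> \<le> ennreal ((L0 * T powr \<alpha> + K) * (1 + S) * (1 + T powr (1 - \<alpha>)))"
  proof (intro ennreal_leI mult_right_mono)
    have "0 \<le> L0 * T powr \<alpha> + K * S" using L0_pos K_pos S0 by simp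
    then show "?C \<le> (L0 * T powr \<alpha> + K) * (1 + S)" by (simp add: algebra_simps)
  qed simp
  finally show ?thesis by (simp only: hoelder_const_def mult_ac)
qed

text \<open>
  The part of the increments proportional to \<open>f\<close> decays like \<open>l powr (\<alpha> - 1)\<close>. It is the term
  \<open>K * (t - s) powr (1 - \<alpha>)\<close>, caused by the section of \<open>b0\<close> and by the time regularity of \<open>b\<close>, that limits
  the rate to \<open>l powr (2 * \<alpha> - 1)\<close>.
\<close>

lemma alpha_norm_F_op_le:
  fixes f :: "real \<Rightarrow> real ^ 'n"
  assumes f: "f \<in> borel_measurable (lebesgue_on {0..T})"
    and S: "\<And>u. u \<in> {0..T} \<Longrightarrow> norm (f u) \<le> S" and l: "1 \<le> l" and M0: "0 \<le> M"
    and M: "\<And>u. u \<in> {0..T} \<Longrightarrow> norm (f u) \<le> M * exp (l * u)"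
  shows "alpha_norm T \<alpha> l (F_op b f)
    \<le> ennreal (growth_const \<mu> \<alpha> T L L0 B / l powr (1 - 2 * \<alpha>) * (1 + M))"
proof -
  let ?a = "L0 * (1 + 1 / (1 - \<alpha>) + 1 / \<alpha>)" and ?q = "l powr - (1 - 2 * \<alpha>)"
  let ?b = "K * (1 + 1 / (1 - 2 * \<alpha>))"
  have a0: "0 \<le> ?a" and b0: "0 \<le> ?b" using L0_pos K_pos \<alpha> by auto
  have q: "l powr - (1 - \<alpha>) \<le> ?q" "l powr (\<alpha> - 1) \<le> ?q" using l \<alpha> by (auto intro!: powr_mono)
  have "alpha_norm T \<alpha> l (F_op b f)
     \<le> ennreal ((L0 * M) * (1 + 1 / (1 - \<alpha>) + 1 / \<alpha>) * l powr (\<alpha> - 1) + ?b * ?q)"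
  proof (rule alpha_norm_le_of_increments[where K = "\<lambda>_. K" and \<kappa> = "1 - \<alpha>"])
    fix s t assume st: "0 \<le> s" "s \<le> t" "t \<le> T"
    have "(\<integral>\<^sup>+u\<in>{s..t}. ennreal (norm (f u)) \<partial>lebesgue)
        \<le> (\<integral>\<^sup>+u\<in>{s..t}. ennreal (M * exp (l * u)) \<partial>lborel)"
      unfolding nn_integral_completion
      using M st by (intro nn_integral_mono) (auto split: split_indicator intro!: ennreal_leI)
    also have "\<dots> \<le> ennreal (M * exp (l * t) * min (t - s) (1 / l))"
      using st l M0 by (intro nn_integral_exp_Icc_le) auto
    finally have "norm (F_op b f t - F_op b f s)
        \<le> L0 * (M * exp (l * t) * min (t - s) (1 / l)) + K * (t - s) powr (1 - \<alpha>)"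
      using F_op_increment_le[OF f S st] st M0 l by simp
    then show "norm (F_op b f t - F_op b f s)
        \<le> L0 * M * exp (l * t) * min (t - s) (1 / l) + K * (t - s) powr (1 - \<alpha>)"
      by (simp only: mult.assoc)
  next
    fix t assume t: "0 \<le> t" "t \<le> T"
    have 1: "exp (- l * t) * t powr (1 - \<alpha>) \<le> ?q"
      using powr_exp_le[of t l "1 - \<alpha>"] t l \<alpha> q by auto
    have 2: "exp (- l * t) * t powr (1 - \<alpha> - \<alpha>) \<le> ?q"
      using powr_exp_le[of t l "1 - \<alpha> - \<alpha>"] t l \<alpha> by simp
    have "exp (- l * t) * (K * (t powr (1 - \<alpha>) + t powr (1 - \<alpha> - \<alpha>) / (1 - \<alpha> - \<alpha>)))
      = K * (exp (- l * t) * t powr (1 - \<alpha>) + exp (- l * t) * t powr (1 - \<alpha> - \<alpha>) * (1 / (1 - 2 * \<alpha>)))"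
      by (simp add: algebra_simps)
    also have "\<dots> \<le> K * (?q + ?q * (1 / (1 - 2 * \<alpha>)))"
      using 1 2 K_pos \<alpha> by (intro mult_left_mono add_mono mult_right_mono) auto
    also have "\<dots> = ?b * ?q" by (simp add: algebra_simps)
    finally show "exp (- l * t) * (K * (t powr (1 - \<alpha>) + t powr (1 - \<alpha> - \<alpha>) / (1 - \<alpha> - \<alpha>))) \<le> ?b * ?q" .
  qed (use \<alpha> l M0 L0_pos K_pos F_op_0 in \<open>auto intro: less_imp_le\<close>)
  also have "\<dots> \<le> ennreal ((?a + ?b) / l powr (1 - 2 * \<alpha>) * (1 + M))"
  proof (rule ennreal_leI)
    have "(L0 * M) * (1 + 1 / (1 - \<alpha>) + 1 / \<alpha>) * l powr (\<alpha> - 1) = (?a * M) * l powr (\<alpha> - 1)"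
      by (simp only: mult_ac)
    also have "\<dots> \<le> (?a * M) * ?q"
      by (rule mult_left_mono[OF q(2) mult_nonneg_nonneg[OF a0 M0]])
    finally have "(L0 * M) * (1 + 1 / (1 - \<alpha>) + 1 / \<alpha>) * l powr (\<alpha> - 1) + ?b * ?q \<le> (?a * M + ?b) * ?q"
      by (simp only: distrib_right add_right_mono)
    also have "\<dots> \<le> ((?a + ?b) * (1 + M)) * ?q"
    proof (rule mult_right_mono)
      have "0 \<le> ?a + ?b * M" using a0 b0 M0 by simp
      moreover have "(?a + ?b) * (1 + M) = (?a * M + ?b) + (?a + ?b * M)"
        by (simp only: distrib_left distrib_right mult_1_right add_ac)
      ultimately show "?a * M + ?b \<le> (?a + ?b) * (1 + M)" by linarith
    qed simp
    also have "\<dots> = (?a + ?b) / l powr (1 - 2 * \<alpha>) * (1 + M)"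
      by (simp only: powr_minus divide_inverse mult_ac)
    finally show "(L0 * M) * (1 + 1 / (1 - \<alpha>) + 1 / \<alpha>) * l powr (\<alpha> - 1) + ?b * ?q
      \<le> (?a + ?b) / l powr (1 - 2 * \<alpha>) * (1 + M)" .
  qed
  finally show ?thesis by (simp only: growth_const_def)
qed

lemma F_op_diff_increment_le:
  fixes f h :: "real \<Rightarrow> real ^ 'n"
  assumes f: "f \<in> borel_measurable (lebesgue_on {0..T})" and h: "h \<in> borel_measurable (lebesgue_on {0..T})"
    and N0: "0 \<le> N" and fN: "\<And>u. u \<in> {0..T} \<Longrightarrow> norm (f u) \<le> N"
    and hN: "\<And>u. u \<in> {0..T} \<Longrightarrow> norm (h u) \<le> N"
    and l: "0 < l" and M0: "0 \<le> M"
    and M: "\<And>u. u \<in> {0..T} \<Longrightarrow> norm (f u - h u) \<le> M * exp (l * u)"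
    and st: "0 \<le> s" "s \<le> t" "t \<le> T"
  shows "norm ((F_op b f t - F_op b h t) - (F_op b f s - F_op b h s))
    \<le> LN N * M * exp (l * t) * min (t - s) (1 / l) + LN N * M * exp (l * t) / l * (t - s)"
proof -
  let ?k = "\<lambda>t u. b t u (f u) - b t u (h u)"
  have int: "set_integrable lebesgue {0..t} (\<lambda>u. b t u (f u))" "set_integrable lebesgue {0..t} (\<lambda>u. b t u (h u))"
    if "t \<in> {0..T}" for t
    using kernel_set_integrable[OF f fN] kernel_set_integrable[OF h hN] that by auto
  have k: "set_integrable lebesgue {0..t} (?k t)" and
    F: "F_op b f t - F_op b h t = (LINT u:{0..t}|lebesgue. ?k t u)" if "t \<in> {0..T}" for t
    using int[OF that] by (auto simp: F_op_def intro: set_integral_diff)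
  have LN: "0 < LN N" using N0 by (rule LN_pos)
  \<comment> \<open>The first piece is controlled by the local Lipschitz condition in \<open>x\<close>.\<close>
  have space: "(\<integral>\<^sup>+u\<in>{s..t}. ennreal (norm (?k t u)) \<partial>lebesgue)
     \<le> ennreal (LN N * M * exp (l * t) * min (t - s) (1 / l))"
  proof -
    have "(\<integral>\<^sup>+u\<in>{s..t}. ennreal (norm (?k t u)) \<partial>lebesgue)
      \<le> (\<integral>\<^sup>+u\<in>{s..t}. ennreal (LN N * M * exp (l * u)) \<partial>lborel)"
      unfolding nn_integral_completion
    proof (rule nn_integral_mono)
      fix u
      have "norm (?k t u) \<le> LN N * M * exp (l * u)" if "u \<in> {s..t}"
      proof -
        have u: "t \<in> {0..T}" "u \<in> {0..T}" using that st by auto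
        then have "norm (?k t u) \<le> LN N * norm (f u - h u)"
          using H N0 fN[of u] hN[of u] unfolding H2_def by blast
        also have "\<dots> \<le> LN N * (M * exp (l * u))" using M[of u] u LN by simp
        finally show ?thesis by (simp add: mult.assoc)
      qed
      then show "ennreal (norm (?k t u)) * indicator {s..t} u \<le> ennreal (LN N * M * exp (l * u)) * indicator {s..t} u"
        by (auto split: split_indicator intro!: ennreal_leI)
    qed
    also have "\<dots> \<le> ennreal (LN N * M * exp (l * t) * min (t - s) (1 / l))"
      using st l M0 LN by (intro nn_integral_exp_Icc_le) auto
    finally show ?thesis .
  qed
  \<comment> \<open>The mixed condition leaves the factor \<open>t - s\<close> outside an integral of \<open>exp (l * u)\<close>, which is
    at most \<open>exp (l * t) / l\<close>.\<close>
  have time: "(\<integral>\<^sup>+u\<in>{0..s}. ennreal (norm (?k t u - ?k s u)) \<partial>lebesgue)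
     \<le> ennreal (LN N * M * exp (l * t) / l * (t - s))"
  proof -
    have "(\<integral>\<^sup>+u\<in>{0..s}. ennreal (norm (?k t u - ?k s u)) \<partial>lebesgue)
      \<le> (\<integral>\<^sup>+u\<in>{0..s}. ennreal (LN N * (t - s) * M * exp (l * u)) \<partial>lborel)"
      unfolding nn_integral_completion
    proof (rule nn_integral_mono)
      fix u
      have "norm (?k t u - ?k s u) \<le> LN N * (t - s) * M * exp (l * u)" if "u \<in> {0..s}"
      proof -
        have u: "t \<in> {0..T}" "s \<in> {0..T}" "u \<in> {0..T}" using that st by auto
        have "?k t u - ?k s u = b t u (f u) - b t u (h u) - b s u (f u) + b s u (h u)" by simp
        also have "norm \<dots> \<le> LN N * \<bar>t - s\<bar> * norm (f u - h u)"
          using u H N0 fN[of u] hN[of u] unfolding H2_def by blast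
        also have "\<dots> \<le> LN N * \<bar>t - s\<bar> * (M * exp (l * u))"
          using M[of u] u LN by (intro mult_left_mono) auto
        finally show ?thesis using st by (simp add: mult.assoc)
      qed
      then show "ennreal (norm (?k t u - ?k s u)) * indicator {0..s} u
         \<le> ennreal (LN N * (t - s) * M * exp (l * u)) * indicator {0..s} u"
        by (auto split: split_indicator intro!: ennreal_leI)
    qed
    also have "\<dots> \<le> ennreal (LN N * (t - s) * M * exp (l * s) * min (s - 0) (1 / l))"
      using st l M0 LN by (intro nn_integral_exp_Icc_le) auto
    also have "\<dots> \<le> ennreal (LN N * (t - s) * M * exp (l * t) * (1 / l))"
      using st l M0 LN by (intro ennreal_leI mult_mono) auto
    also have "LN N * (t - s) * M * exp (l * t) * (1 / l) = LN N * M * exp (l * t) / l * (t - s)"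
      by simp
    finally show ?thesis .
  qed
  have "ennreal (norm ((LINT u:{0..t}|lebesgue. ?k t u) - (LINT u:{0..s}|lebesgue. ?k s u)))
    \<le> (\<integral>\<^sup>+u\<in>{s..t}. ennreal (norm (?k t u)) \<partial>lebesgue)
      + (\<integral>\<^sup>+u\<in>{0..s}. ennreal (norm (?k t u - ?k s u)) \<partial>lebesgue)"
    by (rule norm_volterra_increment_le) (use st k in auto)
  also have "\<dots> \<le> ennreal (LN N * M * exp (l * t) * min (t - s) (1 / l)) + ennreal (LN N * M * exp (l * t) / l * (t - s))"
    by (rule add_mono[OF space time])
  also have "\<dots> = ennreal (LN N * M * exp (l * t) * min (t - s) (1 / l) + LN N * M * exp (l * t) / l * (t - s))"
    using LN M0 l st by (intro ennreal_plus[symmetric]) auto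
  finally show ?thesis
    using LN M0 l st F[of t] F[of s] by (subst (asm) ennreal_le_iff) auto
qed

lemma alpha_norm_F_op_diff_le:
  fixes f h :: "real \<Rightarrow> real ^ 'n"
  assumes f: "f \<in> borel_measurable (lebesgue_on {0..T})" and h: "h \<in> borel_measurable (lebesgue_on {0..T})"
    and N0: "0 \<le> N" and fN: "\<And>u. u \<in> {0..T} \<Longrightarrow> norm (f u) \<le> N"
    and hN: "\<And>u. u \<in> {0..T} \<Longrightarrow> norm (h u) \<le> N"
    and l: "1 \<le> l" and M0: "0 \<le> M"
    and M: "\<And>u. u \<in> {0..T} \<Longrightarrow> norm (f u - h u) \<le> M * exp (l * u)"
  shows "alpha_norm T \<alpha> l (\<lambda>t. F_op b f t - F_op b h t)
    \<le> ennreal (lipschitz_const \<alpha> T (LN N) / l powr (1 - \<alpha>) * M)"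
proof -
  let ?c = "1 + 1 / (1 - \<alpha>) + 1 / \<alpha>" and ?T = "T + T powr (1 - \<alpha>) / (1 - \<alpha>)"
  have LN: "0 < LN N" using N0 by (rule LN_pos)
  have "alpha_norm T \<alpha> l (\<lambda>t. F_op b f t - F_op b h t)
     \<le> ennreal (LN N * M * ?c * l powr (\<alpha> - 1) + LN N * M / l * ?T)"
  proof (rule alpha_norm_le_of_increments[where K = "\<lambda>t. LN N * M * exp (l * t) / l" and \<kappa> = 1])
    fix s t assume st: "0 \<le> s" "s \<le> t" "t \<le> T"
    show "norm (F_op b f t - F_op b h t - (F_op b f s - F_op b h s))
       \<le> LN N * M * exp (l * t) * min (t - s) (1 / l) + LN N * M * exp (l * t) / l * (t - s) powr 1"
      using F_op_diff_increment_le[OF f h N0 fN hN _ M0 M st] l st by simp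
  next
    fix t assume t: "0 \<le> t" "t \<le> T"
    have e: "exp (- l * t) * exp (l * t) = 1" by (simp add: exp_add[symmetric])
    have "exp (- l * t) * (LN N * M * exp (l * t) / l * (t powr 1 + t powr (1 - \<alpha>) / (1 - \<alpha>)))
      = (exp (- l * t) * exp (l * t)) * (LN N * M / l * (t powr 1 + t powr (1 - \<alpha>) / (1 - \<alpha>)))"
      by (simp only: divide_inverse mult_ac)
    also have "\<dots> = LN N * M / l * (t powr 1 + t powr (1 - \<alpha>) / (1 - \<alpha>))" by (simp only: e mult_1_left)
    also have "\<dots> \<le> LN N * M / l * ?T"
      using t \<alpha> LN M0 l by (intro mult_left_mono add_mono divide_right_mono powr_mono2) auto
    finally show "exp (- l * t) * (LN N * M * exp (l * t) / l * (t powr 1 + t powr (1 - \<alpha>) / (1 - \<alpha>)))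
      \<le> LN N * M / l * ?T" .
  qed (use \<alpha> l LN M0 F_op_0 in auto)
  also have "\<dots> \<le> ennreal (LN N * (?c + ?T) / l powr (1 - \<alpha>) * M)"
  proof (rule ennreal_leI)
    have "l powr (- 1) \<le> l powr (\<alpha> - 1)" using l \<alpha> by (intro powr_mono) auto
    then have "1 / l \<le> l powr (\<alpha> - 1)" using l by (simp add: powr_minus divide_inverse)
    then have "(LN N * M * ?T) * (1 / l) \<le> (LN N * M * ?T) * l powr (\<alpha> - 1)"
      using LN M0 T \<alpha> by (intro mult_left_mono) auto
    then have "LN N * M * ?c * l powr (\<alpha> - 1) + LN N * M / l * ?T
       \<le> LN N * M * ?c * l powr (\<alpha> - 1) + (LN N * M * ?T) * l powr (\<alpha> - 1)" by simp
    also have "\<dots> = LN N * (?c + ?T) * l powr - (1 - \<alpha>) * M"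
      by (simp add: distrib_left distrib_right mult_ac) 
    also have "\<dots> = LN N * (?c + ?T) / l powr (1 - \<alpha>) * M"
      by (simp only: powr_minus divide_inverse)
    finally show "LN N * M * ?c * l powr (\<alpha> - 1) + LN N * M / l * ?T
       \<le> LN N * (?c + ?T) / l powr (1 - \<alpha>) * M" .
  qed
  finally show ?thesis by (simp only: lipschitz_const_def add.assoc)
qed

section \<open>Regularity and Lipschitz bounds on \<open>W\<^sub>0\<close>\<close>

text \<open>
  When the weighted norm on the right is infinite, the bound holds because its constant is positive.
  When it is finite, its value serves as the factor \<open>M\<close> of the exponential envelope of \<open>f\<close>,
  respectively of \<open>f - h\<close>.
\<close>

lemma W0_space_growth_estimates:
  fixes f :: "real \<Rightarrow> real ^ 'n"
  assumes W: "f \<in> W0_space T \<alpha>"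
  shows "\<forall>t\<in>{0..T}. set_integrable lebesgue {0..t} (\<lambda>s. b t s (f s))"
    and "F_op b f \<in> hoelder_space T (1 - \<alpha>)"
    and "hoelder_norm T (1 - \<alpha>) (F_op b f) \<le> ennreal (hoelder_const \<mu> \<alpha> T L L0 B) * (1 + sup_norm T f)"
    and "\<forall>l\<ge>1. alpha_norm T \<alpha> l (F_op b f)
      \<le> ennreal (growth_const \<mu> \<alpha> T L L0 B / l powr (1 - 2 * \<alpha>)) * (1 + alpha_norm T \<alpha> l f)"
proof -
  let ?d1 = "hoelder_const \<mu> \<alpha> T L L0 B" and ?d2 = "growth_const \<mu> \<alpha> T L L0 B"
  have f: "f \<in> borel_measurable (lebesgue_on {0..T})" using W by (simp add: W0_space_def)
  obtain S where S: "0 \<le> S" "sup_norm T f = ennreal S" "\<And>u. u \<in> {0..T} \<Longrightarrow> norm (f u) \<le> S"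
    using W0_space_bounded[OF W] by blast
  show "\<forall>t\<in>{0..T}. set_integrable lebesgue {0..t} (\<lambda>s. b t s (f s))"
    using kernel_set_integrable[OF f S(3)] by blast
  have h: "hoelder_norm T (1 - \<alpha>) (F_op b f) \<le> ennreal (?d1 * (1 + S))"
    by (rule hoelder_norm_F_op_le[OF f S(1,3)])
  then show "F_op b f \<in> hoelder_space T (1 - \<alpha>)"
    by (auto simp: hoelder_space_def intro: le_less_trans)
  show "hoelder_norm T (1 - \<alpha>) (F_op b f) \<le> ennreal ?d1 * (1 + sup_norm T f)"
    using h hoelder_const_pos S by (simp add: ennreal_mult)
  show "\<forall>l\<ge>1. alpha_norm T \<alpha> l (F_op b f)
      \<le> ennreal (?d2 / l powr (1 - 2 * \<alpha>)) * (1 + alpha_norm T \<alpha> l f)"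
  proof (intro allI impI)
    fix l :: real assume l: "1 \<le> l"
    have c: "0 < ?d2 / l powr (1 - 2 * \<alpha>)" using growth_const_pos l by simp
    show "alpha_norm T \<alpha> l (F_op b f)
      \<le> ennreal (?d2 / l powr (1 - 2 * \<alpha>)) * (1 + alpha_norm T \<alpha> l f)"
    proof (cases "alpha_norm T \<alpha> l f < \<infinity>")
      case True
      then obtain M where M: "0 \<le> M" "alpha_norm T \<alpha> l f = ennreal M"
        "\<And>u. u \<in> {0..T} \<Longrightarrow> norm (f u) \<le> M * exp (l * u)"
        using norm_le_exp_of_alpha_norm by blast
      have "alpha_norm T \<alpha> l (F_op b f) \<le> ennreal (?d2 / l powr (1 - 2 * \<alpha>) * (1 + M))"
        by (rule alpha_norm_F_op_le[OF f S(3) l M(1,3)])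
      also have "\<dots> = ennreal (?d2 / l powr (1 - 2 * \<alpha>)) * (1 + alpha_norm T \<alpha> l f)"
        using c M by (subst ennreal_mult) auto
      finally show ?thesis .
    next
      case False
      then show ?thesis using growth_const_pos l by (simp add: less_top[symmetric] ennreal_mult_top)
    qed
  qed
qed

lemma W0_space_lipschitz_estimate:
  fixes f h :: "real \<Rightarrow> real ^ 'n"
  assumes N: "0 \<le> N" and fW: "f \<in> W0_space T \<alpha>" and hW: "h \<in> W0_space T \<alpha>"
    and fN: "sup_norm T f \<le> ennreal N" and hN: "sup_norm T h \<le> ennreal N" and l: "1 \<le> l"
  shows "alpha_norm T \<alpha> l (\<lambda>t. F_op b f t - F_op b h t)
    \<le> ennreal (lipschitz_const \<alpha> T (LN N) / l powr (1 - \<alpha>)) * alpha_norm T \<alpha> l (\<lambda>t. f t - h t)"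
proof -
  let ?d = "lipschitz_const \<alpha> T (LN N)"
  have c: "0 < ?d / l powr (1 - \<alpha>)" using lipschitz_const_pos[OF N] l by simp
  have bound: "norm (g u) \<le> N" if "sup_norm T g \<le> ennreal N" "u \<in> {0..T}" for g :: "real \<Rightarrow> real ^ 'n" and u
    using that N by (simp add: sup_norm_def SUP_le_iff)
  show ?thesis
  proof (cases "alpha_norm T \<alpha> l (\<lambda>t. f t - h t) < \<infinity>")
    case True
    then obtain M where M: "0 \<le> M" "alpha_norm T \<alpha> l (\<lambda>t. f t - h t) = ennreal M"
      "\<And>u. u \<in> {0..T} \<Longrightarrow> norm (f u - h u) \<le> M * exp (l * u)"
      using norm_le_exp_of_alpha_norm by blast
    have "alpha_norm T \<alpha> l (\<lambda>t. F_op b f t - F_op b h t) \<le> ennreal (?d / l powr (1 - \<alpha>) * M)"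
      using fW hW fN hN N M l bound by (intro alpha_norm_F_op_diff_le) (auto simp: W0_space_def)
    also have "\<dots> = ennreal (?d / l powr (1 - \<alpha>)) * alpha_norm T \<alpha> l (\<lambda>t. f t - h t)"
      using c M by (subst ennreal_mult) auto
    finally show ?thesis .
  next
    case False
    then show ?thesis using lipschitz_const_pos[OF N] l by (simp add: less_top[symmetric] ennreal_mult_top)
  qed
qed

end

theorem proposition2p2:
  "\<exists>(d1 :: real \<Rightarrow> real \<Rightarrow> real \<Rightarrow> real \<Rightarrow> real \<Rightarrow> real \<Rightarrow> real)
     (d2 :: real \<Rightarrow> real \<Rightarrow> real \<Rightarrow> real \<Rightarrow> real \<Rightarrow> real \<Rightarrow> real)
     (dN :: real \<Rightarrow> real \<Rightarrow> real \<Rightarrow> real)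
     (B :: real \<Rightarrow> real \<Rightarrow> (real \<Rightarrow> real \<Rightarrow> real) \<Rightarrow> real).
   \<forall>(T::real) (\<alpha>::real) (\<mu>::real) (L::real) (L0::real) (LN :: real \<Rightarrow> real)
     (b0 :: real \<Rightarrow> real \<Rightarrow> real) (b :: real \<Rightarrow> real \<Rightarrow> real ^ 'n \<Rightarrow> real ^ 'n).
     0 < T \<longrightarrow> 0 < \<alpha> \<longrightarrow> \<alpha> < 1/2 \<longrightarrow>
     H2 T b (1 / \<alpha>) b0 \<mu> L L0 LN \<longrightarrow> max (1 - \<alpha>) \<alpha> < \<mu> \<longrightarrow>
     0 < d1 \<mu> \<alpha> T L L0 (B \<alpha> T b0) \<and> 0 < d2 \<mu> \<alpha> T L L0 (B \<alpha> T b0) \<and>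
     (\<forall>f\<in>W0_space T \<alpha>.
        (\<forall>t\<in>{0..T}. set_integrable lebesgue {0..t} (\<lambda>s. b t s (f s))) \<and>
        F_op b f \<in> hoelder_space T (1 - \<alpha>) \<and>
        hoelder_norm T (1 - \<alpha>) (F_op b f)
          \<le> ennreal (d1 \<mu> \<alpha> T L L0 (B \<alpha> T b0)) * (1 + sup_norm T f) \<and>
        (\<forall>l\<ge>1. alpha_norm T \<alpha> l (F_op b f)
          \<le> ennreal (d2 \<mu> \<alpha> T L L0 (B \<alpha> T b0) / l powr (1 - 2 * \<alpha>)) * (1 + alpha_norm T \<alpha> l f))) \<and>
     (\<forall>N\<ge>0. \<forall>f\<in>W0_space T \<alpha>. \<forall>h\<in>W0_space T \<alpha>.
        sup_norm T f \<le> ennreal N \<longrightarrow> sup_norm T h \<le> ennreal N \<longrightarrow>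
        (\<forall>l\<ge>1. alpha_norm T \<alpha> l (\<lambda>t. F_op b f t - F_op b h t)
          \<le> ennreal (dN \<alpha> T (LN N) / l powr (1 - \<alpha>)) * alpha_norm T \<alpha> l (\<lambda>t. f t - h t)))"
proof (rule exI[where x = hoelder_const], rule exI[where x = growth_const],
    rule exI[where x = lipschitz_const], rule exI[where x = moment_const],
    intro allI impI, goal_cases)
  case (1 T \<alpha> \<mu> L L0 LN b0 b)
  define B where "B = moment_const \<alpha> T b0"
  have B: "0 \<le> B"
    unfolding B_def moment_const_def using 1 by (intro add_nonneg_nonneg divide_nonneg_pos integral_nonneg_AE) auto
  have \<mu>: "1 - \<alpha> < \<mu>" using 1(5) by simp
  have b0: "(\<lambda>(t, s). b0 t s) \<in> borel_measurable (lebesgue_on ({0..T} \<times> {0..T}))"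
    "integrable (lebesgue_on ({0..T} \<times> {0..T})) (\<lambda>(t, s). b0 t s powr (1 / \<alpha>))"
    using 1(4) by (simp_all only: H2_def)
  obtain r where "r \<in> {0..T}" "b0 r \<in> borel_measurable (lebesgue_on {0..T})"
    "(\<integral>\<^sup>+s\<in>{0..T}. ennreal (b0 r s powr (1 / \<alpha>)) \<partial>lebesgue) \<le> ennreal B"
    unfolding B_def moment_const_def by (rule obtain_Lp_section[OF 1(1) b0])
  then interpret H2_kernel T \<alpha> \<mu> L L0 B r LN b0 b
    using 1(1-4) \<mu> B by (intro H2_kernel.intro)
  show ?case
    using hoelder_const_pos growth_const_pos W0_space_growth_estimates W0_space_lipschitz_estimate
    unfolding B_def by blast
qed

end
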